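(* Let $\Omega\subset\mathbb{R}^n$ ($n\ge1$) be a bounded smooth domain, $a,b>0$ and $3<q<2^*-1$ (with $2^*=+\infty$ for $n=1,2$ and $2^*=\frac{2n}{n-2}$ for $n\ge3$). With $J,I,\mathcal{N},d,S,\lambda_1,G,\gamma$ as in the context, for $s>d$ let $\mathcal{N}_s=\{u\in\mathcal{N}: J(u)<s\}$ and $$\lambda_s=\inf\{\|u\|_2: u\in\mathcal{N}_s\},\qquad \Lambda_s=\sup\{\|u\|_2:u\in\mathcal{N}_s\}.$$ Then for every $s>d$, $$K_1\le\lambda_s\le\Lambda_s\le K_2,$$ where $K_2=\sqrt{\frac{2(q+1)s}{a\lambda_1(q-1)}}$ and $$K_1=\begin{cases}\Big(\frac{a}{G}\Big)^{1/\gamma}\theta^{\frac{4-n(q-1)}{2\gamma}}, & \text{if } q\le 1+\frac4n,\\[2mm] \Big(\frac{a}{G}\Big)^{1/\gamma}\Big[\frac{2(q+1)s}{a(q-1)}\Big]^{\frac{4-n(q-1)}{4\gamma}}, & \text{if } q>1+\frac4n,\end{cases}$$ with $\theta=\Big(\frac{2(q+1)d}{q-1}\Big)^{\frac1{q+1}}S^{-1}$.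
   Context: $\|\cdot\|_r$ is the $L^r(\Omega)$ norm. For $u\in H_0^1(\Omega)$: $J(u)=\frac{a}{2}\|\nabla u\|_2^2+\frac{b}{4}\|\nabla u\|_2^4-\frac{1}{q+1}\|u\|_{q+1}^{q+1}$, $I(u)=a\|\nabla u\|_2^2+b\|\nabla u\|_2^4-\|u\|_{q+1}^{q+1}$, $\mathcal{N}=\{u\in H_0^1(\Omega): I(u)=0,\ \|\nabla u\|_2\ne0\}$, $d=\inf_{u\in\mathcal{N}}J(u)$. $S>0$ is defined by $\frac1S=\inf_{0\ne w\in H_0^1(\Omega)}\frac{\|\nabla w\|_2}{\|w\|_{q+1}}$. $\lambda_1>0$ is the first Dirichlet eigenvalue of $-\Delta$ in $\Omega$. $\gamma=q+1-\frac{n(q-1)}{2}>0$ and $G>0$ is the constant (depending only on $n,q$) in the Gagliardo–Nirenberg inequality $\|u\|_{q+1}^{q+1}\le G\|\nabla u\|_2^{n(q-1)/2}\|u\|_2^{\gamma}$ for all $u\in H_0^1(\Omega)$. *)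

theory Defs
  imports "HOL-Analysis.Analysis"
begin

definition pdiff :: "'n::finite \<Rightarrow> (real^'n \<Rightarrow> real) \<Rightarrow> (real^'n \<Rightarrow> real)" where
  "pdiff i f = (\<lambda>x. frechet_derivative f (at x) (axis i 1))"

fun pdiffs :: "'n::finite list \<Rightarrow> (real^'n \<Rightarrow> real) \<Rightarrow> (real^'n \<Rightarrow> real)" where
  "pdiffs [] f = f"
| "pdiffs (i # is) f = pdiff i (pdiffs is f)"

definition smooth_fun :: "(real^'n::finite \<Rightarrow> real) \<Rightarrow> bool" where
  "smooth_fun f \<longleftrightarrow> (\<forall>is x. pdiffs is f differentiable (at x))"

definition grad :: "(real^'n::finite \<Rightarrow> real) \<Rightarrow> real^'n \<Rightarrow> real^'n" where
  "grad f x = (\<chi> i. pdiff i f x)"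

definition smooth_bounded_domain :: "(real^'n::finite) set \<Rightarrow> bool" where
  "smooth_bounded_domain \<Omega> \<longleftrightarrow> open \<Omega> \<and> connected \<Omega> \<and> bounded \<Omega> \<and> \<Omega> \<noteq> {} \<and>
     (\<exists>\<rho>. smooth_fun \<rho> \<and> \<Omega> = {x. \<rho> x < 0} \<and> (\<forall>x. \<rho> x = 0 \<longrightarrow> grad \<rho> x \<noteq> 0))"

definition test_fun :: "(real^'n::finite) set \<Rightarrow> (real^'n \<Rightarrow> real) \<Rightarrow> bool" where
  "test_fun \<Omega> \<phi> \<longleftrightarrow> smooth_fun \<phi> \<and> compact (closure {x. \<phi> x \<noteq> 0}) \<and> closure {x. \<phi> x \<noteq> 0} \<subseteq> \<Omega>"

definition Lnorm :: "(real^'n::finite) set \<Rightarrow> real \<Rightarrow> (real^'n \<Rightarrow> real) \<Rightarrow> real" where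
  "Lnorm \<Omega> r u = (LINT x:\<Omega>|lebesgue. \<bar>u x\<bar> powr r) powr (1 / r)"

text \<open>\<open>H01 \<Omega> u g\<close>: u belongs to H_0^1(Omega) and g is its (weak) gradient; i.e. (u,g) is the
  limit in L^2 x L^2 of (phi_k, grad phi_k) for test functions phi_k.\<close>
definition H01 :: "(real^'n::finite) set \<Rightarrow> (real^'n \<Rightarrow> real) \<Rightarrow> (real^'n \<Rightarrow> real^'n) \<Rightarrow> bool" where
  "H01 \<Omega> u g \<longleftrightarrow>
     set_borel_measurable lebesgue \<Omega> u \<and> set_borel_measurable lebesgue \<Omega> g \<and>
     set_integrable lebesgue \<Omega> (\<lambda>x. (u x)\<^sup>2) \<and> set_integrable lebesgue \<Omega> (\<lambda>x. (norm (g x))\<^sup>2) \<and>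
     (\<exists>\<phi>::nat \<Rightarrow> real^'n \<Rightarrow> real. (\<forall>k. test_fun \<Omega> (\<phi> k)) \<and>
        (\<lambda>k. LINT x:\<Omega>|lebesgue. (\<phi> k x - u x)\<^sup>2) \<longlonglongrightarrow> 0 \<and>
        (\<lambda>k. LINT x:\<Omega>|lebesgue. (norm (grad (\<phi> k) x - g x))\<^sup>2) \<longlonglongrightarrow> 0)"

definition Jfun :: "(real^'n::finite) set \<Rightarrow> real \<Rightarrow> real \<Rightarrow> real \<Rightarrow> (real^'n \<Rightarrow> real) \<Rightarrow> (real^'n \<Rightarrow> real^'n) \<Rightarrow> real" where
  "Jfun \<Omega> a b q u g = a / 2 * (Lnorm \<Omega> 2 (\<lambda>x. norm (g x)))\<^sup>2 + b / 4 * (Lnorm \<Omega> 2 (\<lambda>x. norm (g x)))^4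
      - 1 / (q + 1) * (Lnorm \<Omega> (q + 1) u) powr (q + 1)"

definition Ifun :: "(real^'n::finite) set \<Rightarrow> real \<Rightarrow> real \<Rightarrow> real \<Rightarrow> (real^'n \<Rightarrow> real) \<Rightarrow> (real^'n \<Rightarrow> real^'n) \<Rightarrow> real" where
  "Ifun \<Omega> a b q u g = a * (Lnorm \<Omega> 2 (\<lambda>x. norm (g x)))\<^sup>2 + b * (Lnorm \<Omega> 2 (\<lambda>x. norm (g x)))^4
      - (Lnorm \<Omega> (q + 1) u) powr (q + 1)"

definition Nehari :: "(real^'n::finite) set \<Rightarrow> real \<Rightarrow> real \<Rightarrow> real \<Rightarrow> ((real^'n \<Rightarrow> real) \<times> (real^'n \<Rightarrow> real^'n)) set" where
  "Nehari \<Omega> a b q = {(u, g). H01 \<Omega> u g \<and> Ifun \<Omega> a b q u g = 0 \<and> Lnorm \<Omega> 2 (\<lambda>x. norm (g x)) \<noteq> 0}"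

definition depth :: "(real^'n::finite) set \<Rightarrow> real \<Rightarrow> real \<Rightarrow> real \<Rightarrow> real" where
  "depth \<Omega> a b q = Inf ((\<lambda>(u, g). Jfun \<Omega> a b q u g) ` Nehari \<Omega> a b q)"

definition Nehari_s :: "(real^'n::finite) set \<Rightarrow> real \<Rightarrow> real \<Rightarrow> real \<Rightarrow> real \<Rightarrow> ((real^'n \<Rightarrow> real) \<times> (real^'n \<Rightarrow> real^'n)) set" where
  "Nehari_s \<Omega> a b q s = {(u, g) \<in> Nehari \<Omega> a b q. Jfun \<Omega> a b q u g < s}"

definition sobolev_S :: "(real^'n::finite) set \<Rightarrow> real \<Rightarrow> real" where
  "sobolev_S \<Omega> q = 1 / Inf {Lnorm \<Omega> 2 (\<lambda>x. norm (g x)) / Lnorm \<Omega> (q + 1) w | w g.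
       H01 \<Omega> w g \<and> Lnorm \<Omega> 2 w \<noteq> 0}"

definition lambda1 :: "(real^'n::finite) set \<Rightarrow> real" where
  "lambda1 \<Omega> = Inf {\<mu>. \<exists>u g. H01 \<Omega> u g \<and> Lnorm \<Omega> 2 u \<noteq> 0 \<and>
      (\<forall>\<phi>. test_fun \<Omega> \<phi> \<longrightarrow>
         (LINT x:\<Omega>|lebesgue. g x \<bullet> grad \<phi> x) = \<mu> * (LINT x:\<Omega>|lebesgue. u x * \<phi> x))}"

end

theory Submission
  imports Defs "HOL-Complex_Analysis.Great_Picard" "HOL-Library.Diagonal_Subsequence"
begin

text \<open>
  On the Nehari set \<open>J\<close> is comparable with the energy: with \<open>X = \<parallel>\<nabla>u\<parallel>\<^sub>2\<close> one has
  \<open>J(u) = a (q - 1) / (2 (q + 1)) X\<^sup>2 + b (q - 3) / (4 (q + 1)) X\<^sup>4\<close>, so \<open>J(u) < s\<close> bounds \<open>X\<close> from above,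
  and \<open>d \<le> J(u)\<close> together with the Sobolev quotient bounds it from below by \<open>\<theta>\<close>. The upper bound on
  \<open>\<parallel>u\<parallel>\<^sub>2\<close> is then Poincare's inequality with constant \<open>\<lambda>\<^sub>1\<close>, and the lower one comes from
  \<open>a X\<^sup>2 \<le> \<parallel>u\<parallel>\<^bsub>q+1\<^esub>\<^bsup>q+1\<^esup> \<le> G X\<^bsup>n(q-1)/2\<^esup> \<parallel>u\<parallel>\<^sub>2\<^bsup>\<gamma>\<^esup>\<close>, the sign of \<open>4 - n (q - 1)\<close> deciding which bound on \<open>X\<close> is used.

  As \<open>\<lambda>\<^sub>1\<close> is defined as the least eigenvalue, its variational characterisation requires an
  eigenfunction. The estimate \<open>\<parallel>f(\<cdot> + h) - f\<parallel>\<^sub>2 \<le> |h| \<parallel>\<nabla>f\<parallel>\<^sub>2\<close> makes averages over small balls equi-Lipschitz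
  and close to \<open>f\<close>, so Arzela--Ascoli gives Rellich compactness for test functions. A minimising sequence
  of the Rayleigh quotient thus has a subsequence that is Cauchy in \<open>L\<^sup>2\<close>; the parallelogram identity makes
  its gradients Cauchy as well, without any weak compactness.
\<close>

section \<open>Square integrable functions\<close>

text \<open>One notion for scalar functions and for gradients. Functions are not identified almost
  everywhere, so L^2 convergence is stated through the integral of the squared distance.\<close>

definition sqint :: "'a measure \<Rightarrow> ('a \<Rightarrow> 'b::euclidean_space) \<Rightarrow> bool" where
  "sqint M f \<longleftrightarrow> f \<in> borel_measurable M \<and> integrable M (\<lambda>x. (norm (f x))\<^sup>2)"

lemma sqint_measurable: "sqint M f \<Longrightarrow> f \<in> borel_measurable M"
  and sqint_integrable: "sqint M f \<Longrightarrow> integrable M (\<lambda>x. (norm (f x))\<^sup>2)"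
  by (auto simp: sqint_def)

lemma sqint_inner_integrable:
  assumes "sqint M f" "sqint M g"
  shows "integrable M (\<lambda>x. f x \<bullet> g x)"
proof (rule Bochner_Integration.integrable_bound)
  show "integrable M (\<lambda>x. (norm (f x))\<^sup>2 + (norm (g x))\<^sup>2)"
    using assms by (intro Bochner_Integration.integrable_add sqint_integrable)
  show "(\<lambda>x. f x \<bullet> g x) \<in> borel_measurable M"
    using assms[THEN sqint_measurable] by measurable
  have "\<bar>f x \<bullet> g x\<bar> \<le> (norm (f x))\<^sup>2 + (norm (g x))\<^sup>2" for x
  proof -
    have "\<bar>f x \<bullet> g x\<bar> \<le> norm (f x) * norm (g x)" by (rule Cauchy_Schwarz_ineq2)
    also have "\<dots> \<le> (norm (f x))\<^sup>2 + (norm (g x))\<^sup>2"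
      using sum_squares_bound[of "norm (f x)" "norm (g x)"]
        mult_nonneg_nonneg[OF norm_ge_zero[of "f x"] norm_ge_zero[of "g x"]] by linarith
    finally show ?thesis .
  qed
  then show "AE x in M. norm (f x \<bullet> g x) \<le> norm ((norm (f x))\<^sup>2 + (norm (g x))\<^sup>2)" by auto
qed

lemma norm_add_scaleR_sq:
  fixes x y :: "'b::real_inner"
  shows "(norm (x + c *\<^sub>R y))\<^sup>2 = (norm x)\<^sup>2 + 2 * c * (x \<bullet> y) + c\<^sup>2 * (norm y)\<^sup>2"
  unfolding power2_norm_eq_inner
  by (simp add: inner_add_left inner_add_right inner_commute power2_eq_square algebra_simps)

text \<open>Cauchy-Schwarz, the parallelogram identity and the first variation of the Rayleigh
  quotient are all read off from this quadratic polynomial in \<open>c\<close>.\<close>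

lemma sqint_lincomb:
  assumes "sqint M f" "sqint M g"
  shows "sqint M (\<lambda>x. f x + c *\<^sub>R g x)"
    and "(LINT x|M. (norm (f x + c *\<^sub>R g x))\<^sup>2) =
      (LINT x|M. (norm (f x))\<^sup>2) + 2 * c * (LINT x|M. f x \<bullet> g x) + c\<^sup>2 * (LINT x|M. (norm (g x))\<^sup>2)"
proof -
  note [measurable] = assms[THEN sqint_measurable]
  note i = sqint_inner_integrable[OF assms] assms[THEN sqint_integrable]
  show "sqint M (\<lambda>x. f x + c *\<^sub>R g x)"
    unfolding sqint_def norm_add_scaleR_sq using i by auto
  show "(LINT x|M. (norm (f x + c *\<^sub>R g x))\<^sup>2) =
      (LINT x|M. (norm (f x))\<^sup>2) + 2 * c * (LINT x|M. f x \<bullet> g x) + c\<^sup>2 * (LINT x|M. (norm (g x))\<^sup>2)"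
    unfolding norm_add_scaleR_sq using i by simp
qed

lemma sqint_diff:
  assumes "sqint M f" "sqint M g"
  shows "sqint M (\<lambda>x. f x - g x)"
  using sqint_lincomb(1)[OF assms, of "-1"] by simp

lemma sqint_Cauchy_Schwarz:
  assumes "sqint M f" "sqint M g"
  shows "(LINT x|M. f x \<bullet> g x)\<^sup>2 \<le> (LINT x|M. (norm (f x))\<^sup>2) * (LINT x|M. (norm (g x))\<^sup>2)"
proof -
  define A B C where "A = (LINT x|M. (norm (f x))\<^sup>2)" and "B = (LINT x|M. f x \<bullet> g x)"
    and "C = (LINT x|M. (norm (g x))\<^sup>2)"
  have q: "0 \<le> A + 2 * c * B + c\<^sup>2 * C" for c
    unfolding A_def B_def C_def sqint_lincomb(2)[OF assms, symmetric]
    by (intro integral_nonneg_AE) auto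
  have C0: "0 \<le> C" unfolding C_def by (intro integral_nonneg_AE) auto
  have "B\<^sup>2 \<le> A * C"
  proof (cases "C = 0")
    case True
    have "B = 0"
    proof (rule ccontr)
      assume "B \<noteq> 0"
      \<comment> \<open>With \<open>C = 0\<close> the polynomial is affine in \<open>c\<close>; this
        choice gives it the value -1.\<close>
      then show False using q[of "- (A + 1) / (2 * B)"] True by (simp add: field_simps)
    qed
    then show ?thesis using True by simp
  next
    case False
    \<comment> \<open>The minimiser of the quadratic.\<close>
    then show ?thesis using q[of "- B / C"] C0
      by (simp add: field_simps power2_eq_square)
  qed
  then show ?thesis by (simp add: A_def B_def C_def)
qed

lemma sqint_limit_inner:
  assumes f: "\<And>k. sqint M (f k)" "sqint M u" and g: "sqint M g"
    and lim: "(\<lambda>k. LINT x|M. (norm (f k x - u x))\<^sup>2) \<longlonglongrightarrow> 0"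
  shows "(\<lambda>k. LINT x|M. f k x \<bullet> g x) \<longlonglongrightarrow> (LINT x|M. u x \<bullet> g x)"
proof -
  let ?D = "\<lambda>k. (LINT x|M. f k x \<bullet> g x) - (LINT x|M. u x \<bullet> g x)"
  have D: "?D k = (LINT x|M. (f k x - u x) \<bullet> g x)" for k
    using sqint_inner_integrable[OF f(1) g] sqint_inner_integrable[OF f(2) g]
    by (simp add: inner_diff_left)
  have le: "(?D k)\<^sup>2 \<le> (LINT x|M. (norm (f k x - u x))\<^sup>2) * (LINT x|M. (norm (g x))\<^sup>2)" for k
    unfolding D by (rule sqint_Cauchy_Schwarz[OF sqint_diff[OF f] g])
  have "(\<lambda>k. (?D k)\<^sup>2) \<longlonglongrightarrow> 0"
    by (rule tendsto_sandwich[OF _ _ tendsto_const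
        tendsto_mult_left_zero[OF lim, of "LINT x|M. (norm (g x))\<^sup>2"]]) (use le in auto)
  from tendsto_real_sqrt[OF this] have "?D \<longlonglongrightarrow> 0"
    by (simp add: tendsto_rabs_zero_iff)
  then show ?thesis by (rule LIM_zero_cancel)
qed

text \<open>Expanding the square gives \<open>|f k|^2 = |f k - u|^2 + 2 <f k, u> - |u|^2\<close>,
  and each term on the right has a known limit.\<close>

lemma sqint_limit_norm:
  assumes f: "\<And>k. sqint M (f k)" "sqint M u"
    and lim: "(\<lambda>k. LINT x|M. (norm (f k x - u x))\<^sup>2) \<longlonglongrightarrow> 0"
  shows "(\<lambda>k. LINT x|M. (norm (f k x))\<^sup>2) \<longlonglongrightarrow> (LINT x|M. (norm (u x))\<^sup>2)"
proof -
  let ?D = "\<lambda>k. LINT x|M. (norm (f k x - u x))\<^sup>2"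
  let ?B = "\<lambda>k. LINT x|M. f k x \<bullet> u x"
  let ?U = "LINT x|M. (norm (u x))\<^sup>2"
  have eq: "(LINT x|M. (norm (f k x))\<^sup>2) = ?D k + 2 * ?B k - ?U" for k
    using sqint_lincomb(2)[OF f(1)[of k] f(2), of "-1"] by simp
  have "?B \<longlonglongrightarrow> (LINT x|M. u x \<bullet> u x)" by (rule sqint_limit_inner[OF f f(2) lim])
  then have "?B \<longlonglongrightarrow> ?U" by (simp add: power2_norm_eq_inner)
  then have "(\<lambda>k. ?D k + 2 * ?B k - ?U) \<longlonglongrightarrow> 0 + 2 * ?U - ?U"
    by (intro tendsto_intros lim)
  then show ?thesis unfolding eq by simp
qed

text \<open>Riesz-Fischer. On a finite measure space an L^2 Cauchy sequence is Cauchy in L^1, hence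
  has an almost everywhere convergent subsequence; Fatou's lemma along it bounds the distance to the
  limit.\<close>

lemma sqint_complete:
  fixes f :: "nat \<Rightarrow> 'a \<Rightarrow> 'b::euclidean_space"
  assumes "finite_measure M" and f: "\<And>k. sqint M (f k)"
    and cau: "\<And>e. e > 0 \<Longrightarrow> \<exists>N. \<forall>i\<ge>N. \<forall>j\<ge>N. (LINT x|M. (norm (f i x - f j x))\<^sup>2) < e"
  obtains g where "sqint M g" "(\<lambda>k. LINT x|M. (norm (f k x - g x))\<^sup>2) \<longlonglongrightarrow> 0"
proof -
  interpret finite_measure M by fact
  note [measurable] = f[THEN sqint_measurable]
  have int: "integrable M h" if "sqint M h" for h :: "'a \<Rightarrow> 'b"
  proof (rule Bochner_Integration.integrable_bound)
    show "integrable M (\<lambda>x. 1 + (norm (h x))\<^sup>2)"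
      using sqint_integrable[OF that] by simp
    show "h \<in> borel_measurable M" by (rule sqint_measurable[OF that])
    have "norm (h x) \<le> 1 + (norm (h x))\<^sup>2" for x
      using sum_squares_bound[of 1 "norm (h x)"] norm_ge_zero[of "h x"] unfolding one_power2 by linarith
    then show "AE x in M. norm (h x) \<le> norm (1 + (norm (h x))\<^sup>2)" by auto
  qed
  have one: "sqint M (\<lambda>_. 1::real)" by (simp add: sqint_def)
  have L1: "(LINT x|M. norm (f i x - f j x))\<^sup>2 \<le> (LINT x|M. (norm (f i x - f j x))\<^sup>2) * measure M (space M)" for i j
  proof -
    have "sqint M (\<lambda>x. norm (f i x - f j x))"
      using sqint_diff[OF f f, of i j] by (auto simp: sqint_def)
    from sqint_Cauchy_Schwarz[OF this one] show ?thesis by simp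
  qed
  obtain r where r: "strict_mono r" "AE x in M. Cauchy (\<lambda>i. f (r i) x)"
  proof (rule cauchy_L1_AE_cauchy_subseq[of M f])
    show "integrable M (f n)" for n by (rule int[OF f])
    fix e :: real assume e: "e > 0"
    \<comment> \<open>Adding 1 keeps the divisor positive when the space has measure 0.\<close>
    let ?m = "measure M (space M) + 1"
    have m: "?m > 0" by (simp add: add_nonneg_pos)
    obtain N where N: "(LINT x|M. (norm (f i x - f j x))\<^sup>2) < e\<^sup>2 / ?m" if "i \<ge> N" "j \<ge> N" for i j
      using cau[of "e\<^sup>2 / ?m"] e m by auto
    have "(LINT x|M. norm (f i x - f j x)) < e" if "i \<ge> N" "j \<ge> N" for i j
    proof -
      have "(LINT x|M. norm (f i x - f j x))\<^sup>2 \<le> (LINT x|M. (norm (f i x - f j x))\<^sup>2) * ?m"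
        using L1[of i j] by (rule order_trans) (intro mult_left_mono integral_nonneg_AE, auto)
      also have "\<dots> < e\<^sup>2" using N[OF that] m by (simp add: field_simps)
      finally show ?thesis using e by (simp add: power2_less_imp_less)
    qed
    then show "\<exists>N. \<forall>i\<ge>N. \<forall>j\<ge>N. (LINT x|M. norm (f i x - f j x)) < e" by auto
  qed auto
  define g where "g x = lim (\<lambda>i. f (r i) x)" for x
  have g[measurable]: "g \<in> borel_measurable M" unfolding g_def by measurable
  have lim: "AE x in M. (\<lambda>i. f (r i) x) \<longlonglongrightarrow> g x"
    using r(2) by eventually_elim (simp add: g_def Cauchy_convergent_iff convergent_LIMSEQ_iff)
  have main: "\<exists>N. \<forall>i\<ge>N. sqint M (\<lambda>x. f i x - g x) \<and> (LINT x|M. (norm (f i x - g x))\<^sup>2) \<le> e"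
    if e: "e > 0" for e
  proof -
    obtain N where N: "(LINT x|M. (norm (f i x - f j x))\<^sup>2) < e" if "i \<ge> N" "j \<ge> N" for i j
      using cau[OF e] by auto
    \<comment> \<open>Freeze \<open>i\<close> and let the second index run to infinity along
      \<open>r\<close>: Fatou's lemma carries the Cauchy bound \<open>e\<close> over to the
      limit.\<close>
    have "sqint M (\<lambda>x. f i x - g x) \<and> (LINT x|M. (norm (f i x - g x))\<^sup>2) \<le> e" if i: "i \<ge> N" for i
    proof -
      have "(\<integral>\<^sup>+x. ennreal ((norm (f i x - g x))\<^sup>2) \<partial>M)
          = (\<integral>\<^sup>+x. liminf (\<lambda>j. ennreal ((norm (f i x - f (r j) x))\<^sup>2)) \<partial>M)"
      proof (rule nn_integral_cong_AE, use lim in eventually_elim)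
        fix x assume "(\<lambda>i. f (r i) x) \<longlonglongrightarrow> g x"
        then have "(\<lambda>j. ennreal ((norm (f i x - f (r j) x))\<^sup>2)) \<longlonglongrightarrow> ennreal ((norm (f i x - g x))\<^sup>2)"
          by (intro tendsto_intros)
        then show "ennreal ((norm (f i x - g x))\<^sup>2) = liminf (\<lambda>j. ennreal ((norm (f i x - f (r j) x))\<^sup>2))"
          by (rule lim_imp_Liminf[OF sequentially_bot, symmetric])
      qed
      also have "\<dots> \<le> liminf (\<lambda>j. \<integral>\<^sup>+x. ennreal ((norm (f i x - f (r j) x))\<^sup>2) \<partial>M)"
        by (rule nn_integral_liminf) measurable
      also have "\<dots> \<le> ennreal e"
      proof (rule Liminf_le)
        show "\<forall>\<^sub>F j in sequentially. (\<integral>\<^sup>+x. ennreal ((norm (f i x - f (r j) x))\<^sup>2) \<partial>M) \<le> ennreal e"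
          unfolding eventually_sequentially
        proof (intro exI allI impI)
          fix j assume "N \<le> j"
          then have "N \<le> r j" using seq_suble[OF r(1), of j] by linarith
          then show "(\<integral>\<^sup>+x. ennreal ((norm (f i x - f (r j) x))\<^sup>2) \<partial>M) \<le> ennreal e"
            using N[OF i, of "r j"] sqint_integrable[OF sqint_diff[OF f f]]
            by (subst nn_integral_eq_integral) (auto intro: ennreal_leI)
        qed
      qed simp
      finally have le: "(\<integral>\<^sup>+x. ennreal ((norm (f i x - g x))\<^sup>2) \<partial>M) \<le> ennreal e" .
      have ig: "integrable M (\<lambda>x. (norm (f i x - g x))\<^sup>2)"
        by (rule integrableI_nonneg) (use le in \<open>auto intro: le_less_trans\<close>)
      then have "(LINT x|M. (norm (f i x - g x))\<^sup>2) \<le> e"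
        using le e by (subst (asm) nn_integral_eq_integral) auto
      then show ?thesis using ig by (auto simp: sqint_def)
    qed
    then show ?thesis by blast
  qed
  show ?thesis
  proof
    obtain N where "sqint M (\<lambda>x. f N x - g x)" using main[of 1] by auto
    \<comment> \<open>\<open>g = f N - (f N - g)\<close> is a difference of square integrable
      functions.\<close>
    from sqint_diff[OF f[of N] this] show "sqint M g" by simp
    show "(\<lambda>k. LINT x|M. (norm (f k x - g x))\<^sup>2) \<longlonglongrightarrow> 0"
    proof (rule LIMSEQ_I)
      fix e :: real assume "0 < e"
      then obtain N where "\<forall>i\<ge>N. (LINT x|M. (norm (f i x - g x))\<^sup>2) \<le> e / 2" using main[of "e/2"] by auto
      moreover have "0 \<le> (LINT x|M. (norm (f i x - g x))\<^sup>2)" for i by (intro integral_nonneg_AE) auto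
      ultimately show "\<exists>N. \<forall>n\<ge>N. norm ((LINT x|M. (norm (f n x - g x))\<^sup>2) - 0) < e"
        using \<open>0 < e\<close> by (intro exI[of _ N]) (auto intro: le_less_trans)
    qed
  qed
qed

section \<open>Test functions\<close>

text \<open>Smoothness is the largest class of differentiable functions closed under partial
  derivatives, so membership in any such class suffices.\<close>

lemma smooth_fun_coinduct:
  assumes "P f" and step: "\<And>f. P f \<Longrightarrow> (\<forall>x. f differentiable (at x)) \<and> (\<forall>i. P (pdiff i f))"
  shows "smooth_fun f"
proof -
  have "P (pdiffs js f)" for js by (induction js) (use assms in auto)
  then show ?thesis using step by (auto simp: smooth_fun_def)
qed

lemma smooth_fun_differentiable: "smooth_fun f \<Longrightarrow> f differentiable (at x)"
  unfolding smooth_fun_def by (metis pdiffs.simps(1))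

lemma pdiffs_append: "pdiffs (xs @ ys) f = pdiffs xs (pdiffs ys f)"
  by (induction xs) auto

lemma smooth_fun_pdiff: "smooth_fun f \<Longrightarrow> smooth_fun (pdiff i f)"
  unfolding smooth_fun_def by (metis pdiffs_append pdiffs.simps)

lemma pdiff_has_derivative: "(f has_derivative f') (at x) \<Longrightarrow> pdiff i f x = f' (axis i 1)"
  unfolding pdiff_def by (simp add: frechet_derivative_at[symmetric])

lemma pdiff_add:
  "f differentiable (at x) \<Longrightarrow> g differentiable (at x) \<Longrightarrow>
    pdiff i (\<lambda>x. f x + g x) x = pdiff i f x + pdiff i g x"
  using pdiff_has_derivative[OF has_derivative_add, of f _ x g]
  by (simp add: frechet_derivative_works pdiff_def)

lemma pdiff_mult:
  "f differentiable (at x) \<Longrightarrow> g differentiable (at x) \<Longrightarrow>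
    pdiff i (\<lambda>x. f x * g x) x = f x * pdiff i g x + pdiff i f x * g x"
  using pdiff_has_derivative[OF has_derivative_mult, of f _ x g]
  by (simp add: frechet_derivative_works pdiff_def)

lemma pdiff_const: "pdiff i (\<lambda>x. c) x = 0"
  by (rule pdiff_has_derivative) simp

lemma pdiff_cmult:
  "f differentiable (at x) \<Longrightarrow> pdiff i (\<lambda>x. c * f x) x = c * pdiff i f x"
  by (simp add: pdiff_mult pdiff_const)

lemma smooth_fun_lincomb:
  fixes f g :: "real^'n::finite \<Rightarrow> real"
  assumes "smooth_fun f" "smooth_fun g"
  shows "smooth_fun (\<lambda>x. f x + c * g x)"
proof (rule smooth_fun_coinduct[where P = "\<lambda>h. \<exists>f g. smooth_fun f \<and> smooth_fun g \<and> h = (\<lambda>x. f x + c * g x)"])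
  show "\<exists>f' g'. smooth_fun f' \<and> smooth_fun g' \<and> (\<lambda>x. f x + c * g x) = (\<lambda>x. f' x + c * g' x)"
    using assms by blast
next
  fix h :: "real^'n \<Rightarrow> real" assume "\<exists>f g. smooth_fun f \<and> smooth_fun g \<and> h = (\<lambda>x. f x + c * g x)"
  then obtain f g where *: "smooth_fun f" "smooth_fun g" "h = (\<lambda>x. f x + c * g x)" by blast
  have d: "f differentiable (at x)" "g differentiable (at x)" for x
    using * by (auto intro: smooth_fun_differentiable)
  have "pdiff i h = (\<lambda>x. pdiff i f x + c * pdiff i g x)" for i
    using d by (auto simp: *(3) pdiff_add pdiff_cmult)
  moreover have "h differentiable (at x)" for x
    unfolding *(3) using d by simp
  ultimately show "(\<forall>x. h differentiable (at x)) \<and>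
      (\<forall>i. \<exists>f g. smooth_fun f \<and> smooth_fun g \<and> pdiff i h = (\<lambda>x. f x + c * g x))"
    using *(1,2)[THEN smooth_fun_pdiff] by blast
qed

lemma smooth_fun_has_derivative_grad:
  assumes "smooth_fun f"
  shows "(f has_derivative (\<lambda>h. grad f x \<bullet> h)) (at x)"
proof -
  let ?D = "frechet_derivative f (at x)"
  have D: "(f has_derivative ?D) (at x)"
    using smooth_fun_differentiable[OF assms] by (simp add: frechet_derivative_works)
  interpret linear ?D using has_derivative_linear[OF D] .
  have "?D h = grad f x \<bullet> h" for h
  proof -
    have "?D h = ?D (\<Sum>i\<in>UNIV. (h $ i) *\<^sub>R axis i 1)"
      by (simp add: basis_expansion flip: scalar_mult_eq_scaleR)
    also have "\<dots> = grad f x \<bullet> h"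
      by (simp add: sum scaleR inner_vec_def grad_def pdiff_def mult.commute)
    finally show ?thesis .
  qed
  then have "?D = (\<lambda>h. grad f x \<bullet> h)" by auto
  then show ?thesis using D by metis
qed

lemma smooth_fun_continuous: "smooth_fun f \<Longrightarrow> continuous_on S f"
  by (meson continuous_at_imp_continuous_on differentiable_imp_continuous_within smooth_fun_differentiable)

lemma smooth_fun_continuous_grad: "smooth_fun f \<Longrightarrow> continuous_on S (grad f)"
  unfolding grad_def by (intro continuous_on_vec_lambda smooth_fun_continuous smooth_fun_pdiff)

lemma grad_lincomb:
  assumes "smooth_fun f" "smooth_fun g"
  shows "grad (\<lambda>x. f x + c * g x) x = grad f x + c *\<^sub>R grad g x"
  using assms[THEN smooth_fun_differentiable]
  by (auto simp: grad_def vec_eq_iff pdiff_add pdiff_cmult)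

text \<open>The complement of the closure is open and \<open>f\<close> vanishes on it, so
  \<open>f\<close> is constant near \<open>x\<close>.\<close>

lemma grad_zero_outside:
  assumes "x \<notin> closure {x. f x \<noteq> 0}"
  shows "grad f x = 0"
proof -
  have "(f has_derivative (\<lambda>h. 0)) (at x)"
  proof (rule has_derivative_transform_within_open[of "\<lambda>_. 0" _ _ _ "- closure {x. f x \<noteq> 0}"])
    show "0 = f y" if "y \<in> - closure {x. f x \<noteq> 0}" for y
      using that closure_subset[of "{x. f x \<noteq> 0}"] by auto
  qed (use assms in auto)
  then show ?thesis by (simp add: grad_def vec_eq_iff pdiff_has_derivative)
qed

section \<open>Test functions as a vector space\<close>

lemma test_fun_smooth: "test_fun \<Omega> f \<Longrightarrow> smooth_fun f"
  by (simp add: test_fun_def)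

lemma test_fun_outside:
  assumes "test_fun \<Omega> f" "x \<notin> \<Omega>" shows "f x = 0" "grad f x = 0"
proof -
  have "x \<notin> closure {x. f x \<noteq> 0}" using assms by (auto simp: test_fun_def)
  then show "grad f x = 0" "f x = 0"
    using grad_zero_outside[of x f] closure_subset[of "{x. f x \<noteq> 0}"] by auto
qed

lemma test_fun_lincomb:
  assumes "test_fun \<Omega> f" "test_fun \<Omega> g"
  shows "test_fun \<Omega> (\<lambda>x. f x + c * g x)"
proof -
  have sub: "closure {x. f x + c * g x \<noteq> 0} \<subseteq> closure {x. f x \<noteq> 0} \<union> closure {x. g x \<noteq> 0}"
    unfolding closure_Un[symmetric] by (intro closure_mono) auto
  have "compact (closure {x. f x + c * g x \<noteq> 0})"
    by (rule compact_closure[THEN iffD2], rule bounded_subset[OF _ closure_subset[THEN subset_trans, OF sub]])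
       (use assms in \<open>auto simp: test_fun_def compact_imp_bounded\<close>)
  with sub show ?thesis
    using assms smooth_fun_lincomb by (auto simp: test_fun_def)
qed

lemma test_fun_zero: "test_fun \<Omega> (\<lambda>x. 0)"
  by (auto simp: test_fun_def pdiff_const fun_eq_iff intro!: smooth_fun_coinduct[where P="\<lambda>f. f = (\<lambda>x. 0)"])

lemma test_fun_cmult: "test_fun \<Omega> f \<Longrightarrow> test_fun \<Omega> (\<lambda>x. c * f x)"
  using test_fun_lincomb[OF test_fun_zero, of \<Omega> f c] by simp

lemma grad_cmult: "smooth_fun f \<Longrightarrow> grad (\<lambda>x. c * f x) x = c *\<^sub>R grad f x"
  by (auto simp: grad_def vec_eq_iff pdiff_cmult smooth_fun_differentiable)

section \<open>A smooth bump built from exp(-1/t)\<close>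

definition flat :: "nat \<Rightarrow> real \<Rightarrow> real" where
  "flat k t = (if t > 0 then exp (- inverse t) * inverse t ^ k else 0)"

text \<open>With s = 1/t the right-hand limit is that of s^(k+1) / exp s at infinity. The expression
  is the difference quotient of \<open>flat k\<close> at 0.\<close>

lemma flat_limit: "((\<lambda>t. flat k t / t) \<longlongrightarrow> 0) (at 0)"
proof -
  have "((\<lambda>t::real. exp (- inverse t) * inverse t ^ Suc k) \<longlongrightarrow> 0) (at_right 0)"
  proof -
    have "((\<lambda>s::real. s ^ Suc k / exp s) \<longlongrightarrow> 0) at_top" by (rule tendsto_power_div_exp_0)
    then have "((\<lambda>t::real. (inverse t) ^ Suc k / exp (inverse t)) \<longlongrightarrow> 0) (at_right 0)"
      by (rule filterlim_compose[OF _ filterlim_inverse_at_top_right])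
    then show ?thesis by (simp add: divide_inverse exp_minus mult.commute)
  qed
  then have r: "((\<lambda>t. flat k t / t) \<longlongrightarrow> 0) (at_right 0)"
    by (rule Lim_transform_eventually) (auto intro!: always_eventually simp: flat_def eventually_at_filter divide_inverse)
  have l: "((\<lambda>t. flat k t / t) \<longlongrightarrow> 0) (at_left 0)"
    by (rule Lim_transform_eventually[of "\<lambda>_. 0"]) (auto intro!: always_eventually simp: flat_def eventually_at_filter)
  show ?thesis using l r by (simp add: filterlim_split_at)
qed

text \<open>Carrying the exponent \<open>k\<close> closes the family under differentiation: every
  derivative of exp(-1/t) is again a combination of its members.\<close>

lemma flat_deriv:
  "(flat k has_real_derivative (flat (k + 2) t - real k * flat (k + 1) t)) (at t)"
proof -
  consider "t < 0" | "t = 0" | "t > 0" by linarith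
  then show ?thesis
  proof cases
    case 1
    have "((\<lambda>_. 0) has_real_derivative 0) (at t)" by simp
    then have "(flat k has_real_derivative 0) (at t)"
      by (rule has_field_derivative_transform_within_open[of _ _ _ "{..<0}"]) (use 1 in \<open>auto simp: flat_def\<close>)
    then show ?thesis using 1 by (simp add: flat_def)
  next
    case 2
    then show ?thesis using flat_limit[of k]
      by (simp add: has_field_derivative_iff flat_def)
  next
    case 3
    have "((\<lambda>t. exp (- inverse t) * inverse t ^ k) has_real_derivative (flat (k + 2) t - real k * flat (k + 1) t)) (at t)"
    proof -
      have "((\<lambda>t. exp (- inverse t) * inverse t ^ k) has_real_derivative
          exp (- inverse t) * (inverse t)\<^sup>2 * inverse t ^ k
          - exp (- inverse t) * (real k * inverse t ^ (k - Suc 0) * (inverse t)\<^sup>2)) (at t)"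
        using 3 by (auto intro!: derivative_eq_intros simp: power2_eq_square)
      \<comment> \<open>For \<open>k = 0\<close> the truncated exponent \<open>k - Suc 0\<close>
        does no harm, since the factor \<open>real k\<close> vanishes.\<close>
      moreover have "real k * inverse t ^ (k - Suc 0) * (inverse t)\<^sup>2 = real k * inverse t ^ (k + 1)"
        by (cases k) (auto simp: power2_eq_square)
      moreover have "flat (k + 2) t - real k * flat (k + 1) t = exp (- inverse t) * (inverse t)\<^sup>2 * inverse t ^ k
          - exp (- inverse t) * (real k * inverse t ^ (k + 1))"
        using 3 by (simp add: flat_def power2_eq_square)
      ultimately show ?thesis by (simp only:)
    qed
    then show ?thesis
      by (rule has_field_derivative_transform_within_open[of _ _ _ "{0<..}"]) (use 3 in \<open>auto simp: flat_def\<close>)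
  qed
qed

text \<open>A class of differentiable functions closed under partial derivatives that contains the bump
  \<open>exp (-1 / (r\<^sup>2 - |x - c|\<^sup>2))\<close> consists of smooth functions.\<close>

inductive flat_alg :: "real^'n::finite \<Rightarrow> real \<Rightarrow> (real^'n \<Rightarrow> real) \<Rightarrow> bool" for c r where
  const: "flat_alg c r (\<lambda>x. a)"
| coord: "flat_alg c r (\<lambda>x. x $ i)"
| flat: "flat_alg c r (\<lambda>x. flat k (r\<^sup>2 - (x - c) \<bullet> (x - c)))"
| add: "flat_alg c r f \<Longrightarrow> flat_alg c r g \<Longrightarrow> flat_alg c r (\<lambda>x. f x + g x)"
| mult: "flat_alg c r f \<Longrightarrow> flat_alg c r g \<Longrightarrow> flat_alg c r (\<lambda>x. f x * g x)"

lemma flat_comp_deriv: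
  "((\<lambda>x. flat k (r\<^sup>2 - (x - c) \<bullet> (x - c))) has_derivative
    (\<lambda>h. - (2 * ((x - c) \<bullet> h)) *
      (flat (k + 2) (r\<^sup>2 - (x - c) \<bullet> (x - c)) - real k * flat (k + 1) (r\<^sup>2 - (x - c) \<bullet> (x - c))))) (at x)"
  by (rule derivative_eq_intros DERIV_compose_FDERIV[OF flat_deriv] refl)+
     (auto simp: inner_commute algebra_simps)

lemma flat_alg_step:
  fixes f :: "real^'n::finite \<Rightarrow> real"
  assumes "flat_alg c r f"
  shows "(\<forall>x. f differentiable (at x)) \<and> (\<forall>i. flat_alg c r (pdiff i f))"
  using assms
proof induction
  case (const a)
  have "pdiff i (\<lambda>x. a) = (\<lambda>x. 0)" for i :: 'n by (simp add: pdiff_const fun_eq_iff)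
  then show ?case by (auto intro: flat_alg.const)
next
  case (coord j)
  have D: "((\<lambda>x. x $ j) has_derivative (\<lambda>h. h $ j)) (at x)" for x :: "real^'n"
    by (rule bounded_linear_imp_has_derivative[OF bounded_linear_vec_nth])
  have "pdiff i (\<lambda>x. x $ j) = (\<lambda>x. axis i 1 $ j)" for i
    by (rule ext) (rule pdiff_has_derivative[OF D])
  then show ?case using D by (auto intro: flat_alg.const simp: differentiable_def)
next
  case (flat k)
  let ?w = "\<lambda>x. r\<^sup>2 - (x - c) \<bullet> (x - c)"
  have "pdiff i (\<lambda>x. flat k (?w x)) =
    (\<lambda>x. ((-2) * (x $ i + (- (c $ i)))) * (flat (k + 2) (?w x) + (- real k) * flat (k + 1) (?w x)))" for i
    by (rule ext) (simp add: pdiff_has_derivative[OF flat_comp_deriv] inner_axis)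
  then have "flat_alg c r (pdiff i (\<lambda>x. flat k (?w x)))" for i
    by (simp only:) (intro flat_alg.intros)
  moreover have "(\<lambda>x. flat k (?w x)) differentiable (at x)" for x
    unfolding differentiable_def using flat_comp_deriv by blast
  ultimately show ?case by blast
next
  case (add f g)
  then have "pdiff i (\<lambda>x. f x + g x) = (\<lambda>x. pdiff i f x + pdiff i g x)" for i by (auto simp: pdiff_add)
  then show ?case using add by (auto intro: flat_alg.intros)
next
  case (mult f g)
  then have "pdiff i (\<lambda>x. f x * g x) = (\<lambda>x. f x * pdiff i g x + pdiff i f x * g x)" for i by (auto simp: pdiff_mult)
  then show ?case using mult by (auto intro!: flat_alg.add flat_alg.mult)
qed

lemma test_fun_exists:
  assumes "open \<Omega>" "\<Omega> \<noteq> {}"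
  obtains f x where "test_fun \<Omega> f" "f x \<noteq> 0"
proof -
  obtain c where "c \<in> \<Omega>" using assms by blast
  then obtain r where r: "r > 0" "cball c r \<subseteq> \<Omega>"
    using assms open_contains_cball by blast
  \<comment> \<open>Nonzero exactly on the open ball of radius \<open>r\<close> about
    \<open>c\<close>, whose closure lies in \<open>\<Omega>\<close>.\<close>
  define f where "f x = flat 0 (r\<^sup>2 - (x - c) \<bullet> (x - c))" for x
  have f: "x \<in> cball c r" if "f x \<noteq> 0" for x
  proof -
    have "(dist c x)\<^sup>2 < r\<^sup>2"
      using that by (auto simp: f_def flat_def dist_norm norm_minus_commute[of c] power2_norm_eq_inner
          split: if_splits)
    then have "dist c x < r" by (rule power2_less_imp_less) (use r in simp)
    then show ?thesis by simp
  qed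
  then have sub: "closure {x. f x \<noteq> 0} \<subseteq> cball c r" by (intro closure_minimal) auto
  show ?thesis
  proof
    have "smooth_fun f"
      unfolding f_def by (rule smooth_fun_coinduct[where P = "flat_alg c r"])
        (auto intro: flat_alg.flat dest: flat_alg_step)
    moreover have "bounded {x. f x \<noteq> 0}"
      by (rule bounded_subset[OF bounded_cball]) (use f in auto)
    ultimately show "test_fun \<Omega> f"
      using sub r by (auto simp: test_fun_def)
    show "f c \<noteq> 0" using r by (simp add: f_def flat_def)
  qed
qed

section \<open>Translations and the Poincare inequality\<close>

lemma lborel_nn_integral_translate:
  fixes f :: "'a::euclidean_space \<Rightarrow> ennreal"
  assumes [measurable]: "f \<in> borel_measurable borel"
  shows "(\<integral>\<^sup>+x. f (c + x) \<partial>lborel) = (\<integral>\<^sup>+x. f x \<partial>lborel)"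
  by (subst (2) lborel_distr_plus[of c, symmetric]) (simp add: nn_integral_distr)

text \<open>The fundamental theorem of calculus, then Cauchy-Schwarz on an interval of length 1.
  Working with extended nonnegative integrals lets integrations be exchanged later without
  integrability conditions.\<close>

lemma increment_sq_le:
  fixes k k' :: "real \<Rightarrow> real"
  assumes d: "\<And>t. (k has_real_derivative k' t) (at t)" and c: "continuous_on UNIV k'"
  shows "ennreal ((k 1 - k 0)\<^sup>2) \<le> (\<integral>\<^sup>+t. ennreal (indicator {0..1} t * (k' t)\<^sup>2) \<partial>lborel)"
proof -
  have ic: "isCont k' t" for t using c by (simp add: continuous_on_eq_continuous_at)
  have [measurable]: "k' \<in> borel_measurable borel" using c by (rule borel_measurable_continuous_onI)
  have *: "has_bochner_integral lborel (\<lambda>t. k' t * indicator {0..1} t) (k 1 - k 0)"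
    by (rule has_bochner_integral_FTC_Icc_real) (use d ic in auto)
  have "ennreal \<bar>k 1 - k 0\<bar> \<le> (\<integral>\<^sup>+t. ennreal (\<bar>k' t * indicator {0..1} t\<bar>) \<partial>lborel)"
    using integral_norm_bound_ennreal[OF integrable.intros, OF *]
    by (simp add: has_bochner_integral_integral_eq[OF *])
  \<comment> \<open>The indicator is idempotent; its second copy is the other factor for
    Cauchy-Schwarz and contributes an integral of 1.\<close>
  also have "\<dots> = (\<integral>\<^sup>+t. ennreal \<bar>k' t * indicator {0..1} t\<bar> * indicator {0..1} t \<partial>lborel)"
    by (intro nn_integral_cong) (auto simp: indicator_def)
  finally have "(ennreal \<bar>k 1 - k 0\<bar>)\<^sup>2 \<le> \<dots>\<^sup>2" by (rule power_mono) simp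
  also have "\<dots> \<le> (\<integral>\<^sup>+t. (ennreal \<bar>k' t * indicator {0..1} t\<bar>)\<^sup>2 \<partial>lborel) * (\<integral>\<^sup>+t. (indicator {0..1::real} t)\<^sup>2 \<partial>lborel)"
    by (rule Cauchy_Schwarz_nn_integral) measurable
  also have "(\<integral>\<^sup>+t. (indicator {0..1::real} t)\<^sup>2 \<partial>lborel) = (\<integral>\<^sup>+t. indicator {0..1::real} t \<partial>lborel)"
    by (intro nn_integral_cong) (auto simp: indicator_def)
  also have "\<dots> = 1" by simp
  also have "(\<integral>\<^sup>+t. (ennreal \<bar>k' t * indicator {0..1} t\<bar>)\<^sup>2 \<partial>lborel)
      = (\<integral>\<^sup>+t. ennreal (indicator {0..1} t * (k' t)\<^sup>2) \<partial>lborel)"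
    by (intro nn_integral_cong) (auto simp: indicator_def ennreal_power)
  finally show ?thesis by (simp add: ennreal_power)
qed

text \<open>The increment is an integral along the segment from \<open>x\<close> to
  \<open>x + h\<close>. Once the integrals are exchanged, translation invariance makes the inner
  integral over \<open>x\<close> independent of \<open>t\<close>.\<close>

lemma translation_estimate:
  fixes f :: "'a::euclidean_space \<Rightarrow> real" and G :: "'a \<Rightarrow> 'a"
  assumes d: "\<And>x. (f has_derivative (\<lambda>v. G x \<bullet> v)) (at x)" and c: "continuous_on UNIV G"
  shows "(\<integral>\<^sup>+x. ennreal ((f (x + h) - f x)\<^sup>2) \<partial>lborel)
    \<le> ennreal ((norm h)\<^sup>2) * (\<integral>\<^sup>+x. ennreal ((norm (G x))\<^sup>2) \<partial>lborel)"
proof -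
  have [measurable]: "G \<in> borel_measurable borel" using c by (rule borel_measurable_continuous_onI)
  let ?I = "\<lambda>t. indicator {0..1} t :: real"
  let ?g = "ennreal ((norm h)\<^sup>2) * (\<integral>\<^sup>+x. ennreal ((norm (G x))\<^sup>2) \<partial>lborel)"
  have "ennreal ((f (x + h) - f x)\<^sup>2) \<le> (\<integral>\<^sup>+t. ennreal (?I t * (G (t *\<^sub>R h + x) \<bullet> h)\<^sup>2) \<partial>lborel)" for x
  proof -
    have "((\<lambda>t. f (t *\<^sub>R h + x)) has_real_derivative (G (t *\<^sub>R h + x) \<bullet> h)) (at t)" for t
    proof -
      have "((\<lambda>t. f (t *\<^sub>R h + x)) has_derivative (\<lambda>s. G (t *\<^sub>R h + x) \<bullet> (s *\<^sub>R h))) (at t)"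
        by (rule has_derivative_compose[OF _ d]) (auto intro!: derivative_eq_intros)
      then show ?thesis by (simp add: has_field_derivative_def mult.commute[of _ "G (t *\<^sub>R h + x) \<bullet> h"])
    qed
    moreover have "continuous_on UNIV (\<lambda>t. G (t *\<^sub>R h + x) \<bullet> h)"
      by (intro continuous_intros continuous_on_compose2[OF c]) auto
    ultimately show ?thesis using increment_sq_le[of "\<lambda>t. f (t *\<^sub>R h + x)"] by (simp add: add.commute)
  qed
  then have "(\<integral>\<^sup>+x. ennreal ((f (x + h) - f x)\<^sup>2) \<partial>lborel)
      \<le> (\<integral>\<^sup>+x. \<integral>\<^sup>+t. ennreal (?I t * (G (t *\<^sub>R h + x) \<bullet> h)\<^sup>2) \<partial>lborel \<partial>lborel)"
    by (intro nn_integral_mono) auto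
  also have "\<dots> = (\<integral>\<^sup>+t. \<integral>\<^sup>+x. ennreal (?I t * (G (t *\<^sub>R h + x) \<bullet> h)\<^sup>2) \<partial>lborel \<partial>lborel)"
    by (rule lborel_pair.Fubini'[symmetric]) measurable
  also have "\<dots> \<le> (\<integral>\<^sup>+t. ?g * indicator {0..1::real} t \<partial>lborel)"
  proof (rule nn_integral_mono)
    fix t :: real
    have "(\<integral>\<^sup>+x. ennreal (?I t * (G (t *\<^sub>R h + x) \<bullet> h)\<^sup>2) \<partial>lborel)
        \<le> (\<integral>\<^sup>+x. (ennreal ((norm h)\<^sup>2) * indicator {0..1} t) * ennreal ((norm (G (t *\<^sub>R h + x)))\<^sup>2) \<partial>lborel)"
    proof (rule nn_integral_mono)
      fix x
      have "(G (t *\<^sub>R h + x) \<bullet> h)\<^sup>2 \<le> (norm h)\<^sup>2 * (norm (G (t *\<^sub>R h + x)))\<^sup>2"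
        using power_mono[OF Cauchy_Schwarz_ineq2[of "G (t *\<^sub>R h + x)" h] abs_ge_zero, of 2]
        by (simp add: power_mult_distrib mult.commute)
      then show "ennreal (?I t * (G (t *\<^sub>R h + x) \<bullet> h)\<^sup>2)
          \<le> (ennreal ((norm h)\<^sup>2) * indicator {0..1} t) * ennreal ((norm (G (t *\<^sub>R h + x)))\<^sup>2)"
        by (auto simp: indicator_def ennreal_mult[symmetric] intro: ennreal_leI)
    qed
    also have "\<dots> = (ennreal ((norm h)\<^sup>2) * indicator {0..1} t) *
        (\<integral>\<^sup>+x. ennreal ((norm (G (t *\<^sub>R h + x)))\<^sup>2) \<partial>lborel)"
      by (rule nn_integral_cmult) measurable
    also have "(\<integral>\<^sup>+x. ennreal ((norm (G (t *\<^sub>R h + x)))\<^sup>2) \<partial>lborel) = (\<integral>\<^sup>+x. ennreal ((norm (G x))\<^sup>2) \<partial>lborel)"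
      by (rule lborel_nn_integral_translate[of "\<lambda>x. ennreal ((norm (G x))\<^sup>2)"]) measurable
    finally show "(\<integral>\<^sup>+x. ennreal (?I t * (G (t *\<^sub>R h + x) \<bullet> h)\<^sup>2) \<partial>lborel) \<le> ?g * indicator {0..1} t"
      by (simp add: mult_ac)
  qed
  also have "\<dots> = ?g" by (subst nn_integral_cmult) auto
  finally show ?thesis .
qed

section \<open>Test functions integrated over the whole space\<close>

lemma integrable_continuous_compact_support:
  fixes f :: "'a::euclidean_space \<Rightarrow> real"
  assumes "continuous_on UNIV f" "compact K" "\<And>x. x \<notin> K \<Longrightarrow> f x = 0"
  shows "integrable lborel f"
proof -
  have "integrable lborel (\<lambda>x. indicator K x *\<^sub>R f x)"
    by (intro borel_integrable_compact continuous_on_subset[OF assms(1)] assms(2)) simp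
  moreover have "(\<lambda>x. indicator K x *\<^sub>R f x) = f"
    using assms(3) by (auto simp: fun_eq_iff indicator_def)
  ultimately show ?thesis by simp
qed

lemma sqint_test_fun:
  assumes "test_fun \<Omega> f"
  shows "sqint lborel f" "sqint lborel (grad f)"
proof -
  let ?K = "closure {x. f x \<noteq> 0}"
  have K: "compact ?K" using assms by (simp add: test_fun_def)
  have c: "continuous_on UNIV f" "continuous_on UNIV (grad f)"
    using test_fun_smooth[OF assms] smooth_fun_continuous smooth_fun_continuous_grad by blast+
  have z: "f x = 0" "grad f x = 0" if "x \<notin> ?K" for x
    using that closure_subset[of "{x. f x \<noteq> 0}"] grad_zero_outside[OF that] by auto
  have "integrable lborel (\<lambda>x. (norm (f x))\<^sup>2)"
  proof (rule integrable_continuous_compact_support[OF _ K])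
    show "continuous_on UNIV (\<lambda>x. (norm (f x))\<^sup>2)"
      by (intro continuous_on_power continuous_on_norm c)
    show "(norm (f x))\<^sup>2 = 0" if "x \<notin> ?K" for x
      using z[OF that] by simp
  qed
  then show "sqint lborel f" using borel_measurable_continuous_onI[OF c(1)] by (simp add: sqint_def)
  have "integrable lborel (\<lambda>x. (norm (grad f x))\<^sup>2)"
  proof (rule integrable_continuous_compact_support[OF _ K])
    show "continuous_on UNIV (\<lambda>x. (norm (grad f x))\<^sup>2)"
      by (intro continuous_on_power continuous_on_norm c)
    show "(norm (grad f x))\<^sup>2 = 0" if "x \<notin> ?K" for x
      using z[OF that] by simp
  qed
  then show "sqint lborel (grad f)" using borel_measurable_continuous_onI[OF c(2)] by (simp add: sqint_def)
qed

lemma sqint_translate: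
  fixes f :: "'a::euclidean_space \<Rightarrow> 'b::euclidean_space"
  assumes "sqint lborel f"
  shows "sqint lborel (\<lambda>x. f (c + x))"
    and "(LINT x|lborel. (norm (f (c + x)))\<^sup>2) = (LINT x|lborel. (norm (f x))\<^sup>2)"
proof -
  have [measurable]: "f \<in> borel_measurable borel" using sqint_measurable[OF assms] by simp
  have i: "integrable (distr lborel borel ((+) c)) (\<lambda>x. (norm (f x))\<^sup>2)"
    using sqint_integrable[OF assms] by (simp add: lborel_distr_plus)
  have "integrable lborel (\<lambda>x. (norm (f (c + x)))\<^sup>2)"
    by (rule integrable_distr[OF _ i]) simp
  then show "sqint lborel (\<lambda>x. f (c + x))" by (simp add: sqint_def)
  have "(LINT x|distr lborel borel ((+) c). (norm (f x))\<^sup>2) = (LINT x|lborel. (norm (f (c + x)))\<^sup>2)"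
    by (rule integral_distr) simp_all
  then show "(LINT x|lborel. (norm (f (c + x)))\<^sup>2) = (LINT x|lborel. (norm (f x))\<^sup>2)"
    by (simp add: lborel_distr_plus)
qed

lemma test_fun_translation_nn:
  assumes "test_fun \<Omega> f"
  shows "(\<integral>\<^sup>+x. ennreal ((f (x + h) - f x)\<^sup>2) \<partial>lborel)
    \<le> ennreal ((norm h)\<^sup>2 * (LINT x|lborel. (norm (grad f x))\<^sup>2))"
proof -
  have "(\<integral>\<^sup>+x. ennreal ((f (x + h) - f x)\<^sup>2) \<partial>lborel)
      \<le> ennreal ((norm h)\<^sup>2) * (\<integral>\<^sup>+x. ennreal ((norm (grad f x))\<^sup>2) \<partial>lborel)"
    using test_fun_smooth[OF assms]
    by (intro translation_estimate smooth_fun_has_derivative_grad smooth_fun_continuous_grad)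
  then show ?thesis
    using sqint_integrable[OF sqint_test_fun(2)[OF assms]]
    by (subst (asm) nn_integral_eq_integral) (auto simp: ennreal_mult)
qed

lemma test_fun_translation:
  assumes "test_fun \<Omega> f"
  shows "(LINT x|lborel. (f (x + h) - f x)\<^sup>2) \<le> (norm h)\<^sup>2 * (LINT x|lborel. (norm (grad f x))\<^sup>2)"
proof -
  have "integrable lborel (\<lambda>x. (f (x + h) - f x)\<^sup>2)"
    using sqint_integrable[OF sqint_diff[OF sqint_translate(1)[of f h] sqint_test_fun(1)[OF assms]]]
      sqint_test_fun(1)[OF assms] by (simp add: add.commute)
  then have "ennreal (LINT x|lborel. (f (x + h) - f x)\<^sup>2) = (\<integral>\<^sup>+x. ennreal ((f (x + h) - f x)\<^sup>2) \<partial>lborel)"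
    by (subst nn_integral_eq_integral) auto
  also have "\<dots> \<le> ennreal ((norm h)\<^sup>2 * (LINT x|lborel. (norm (grad f x))\<^sup>2))"
    by (rule test_fun_translation_nn[OF assms])
  finally show ?thesis
    by (subst (asm) ennreal_le_iff) (auto intro!: mult_nonneg_nonneg integral_nonneg_AE)
qed

text \<open>A translation by more than the diameter separates \<open>\<Omega>\<close> from its image.\<close>

lemma Poincare_test_fun:
  fixes \<Omega> :: "(real^'n::finite) set"
  assumes "bounded \<Omega>"
  obtains C where "C > 0" "\<And>f. test_fun \<Omega> f \<Longrightarrow>
    (LINT x|lborel. (f x)\<^sup>2) \<le> C * (LINT x|lborel. (norm (grad f x))\<^sup>2)"
proof -
  obtain R where R: "R > 0" "\<And>x. x \<in> \<Omega> \<Longrightarrow> norm x \<le> R"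
    using assms bounded_pos by blast
  obtain e :: "real^'n" where e: "norm e = 1" using nonempty_Basis norm_Basis by blast
  \<comment> \<open>Two points of \<open>\<Omega>\<close> lie at distance at most
    \<open>2 * R\<close>. The squared length of \<open>h\<close> becomes the Poincare
    constant.\<close>
  define h where "h = (2 * R + 1) *\<^sub>R e"
  have h: "norm h = 2 * R + 1" using R e by (simp add: h_def)
  show ?thesis
  proof
    show "(norm h)\<^sup>2 > 0" using h R by simp
    fix f assume f: "test_fun \<Omega> f"
    \<comment> \<open>At most one of \<open>f x\<close> and \<open>f (x + h)\<close> is
      nonzero.\<close>
    have le: "(f x)\<^sup>2 \<le> (f (x + h) - f x)\<^sup>2" for x
    proof (cases "x \<in> \<Omega>")
      case True
      have "x + h \<notin> \<Omega>"
      proof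
        assume "x + h \<in> \<Omega>"
        then have "norm h \<le> R + R" using R(2)[OF True] R(2)[of "x + h"] norm_triangle_ineq4[of "x + h" x] by simp
        then show False using h by simp
      qed
      then show ?thesis using test_fun_outside[OF f] by simp
    next
      case False
      then show ?thesis using test_fun_outside[OF f] by simp
    qed
    have "(LINT x|lborel. (f x)\<^sup>2) \<le> (LINT x|lborel. (f (x + h) - f x)\<^sup>2)"
      using sqint_integrable[OF sqint_diff[OF sqint_translate(1)[of f h] sqint_test_fun(1)[OF f]]]
        sqint_test_fun(1)[OF f] le
      by (intro integral_mono) (auto simp: add.commute sqint_def)
    also have "\<dots> \<le> (norm h)\<^sup>2 * (LINT x|lborel. (norm (grad f x))\<^sup>2)"
      by (rule test_fun_translation[OF f])
    finally show "(LINT x|lborel. (f x)\<^sup>2) \<le> (norm h)\<^sup>2 * (LINT x|lborel. (norm (grad f x))\<^sup>2)" .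
  qed
qed

section \<open>Rellich compactness\<close>

text \<open>Mollification by a normalised indicator. It only produces Lipschitz functions, but
  Arzela-Ascoli asks for no more.\<close>

definition ball_mean :: "real \<Rightarrow> ('a::euclidean_space \<Rightarrow> real) \<Rightarrow> 'a \<Rightarrow> real" where
  "ball_mean \<delta> f x = (LINT y|lborel. f (x + y) * indicator (cball 0 \<delta>) y) / measure lborel (cball (0::'a) \<delta>)"

context
  fixes \<delta> :: real and B :: "'a::euclidean_space set" and V :: real
  assumes \<delta>: "\<delta> > 0"
  defines "B \<equiv> cball 0 \<delta>" and "V \<equiv> measure lborel (cball (0::'a) \<delta>)"
begin

lemma measure_cball_pos: "V > 0"
  using \<delta> by (simp add: V_def content_cball_pos)

lemma sqint_indicator_cball: "sqint lborel (indicator B :: 'a \<Rightarrow> real)"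
  and integral_indicator_cball: "(LINT x|lborel. (norm (indicator B x :: real))\<^sup>2) = V"
proof -
  have [simp]: "(indicator B x :: real)\<^sup>2 = indicator B x" for x by (auto simp: indicator_def)
  have [measurable]: "B \<in> sets borel" by (simp add: B_def)
  show "sqint lborel (indicator B :: 'a \<Rightarrow> real)"
    using emeasure_lborel_cball_finite[of "0::'a" \<delta>] by (simp add: sqint_def B_def[symmetric])
  show "(LINT x|lborel. (norm (indicator B x :: real))\<^sup>2) = V" by (simp add: V_def B_def[symmetric])
qed

text \<open>Cauchy-Schwarz against the indicator of the ball, whose squared norm \<open>V\<close>
  cancels one of the two factors \<open>V\<close> in the denominator.\<close>

lemma mean_sq_le:
  fixes F :: "'a \<Rightarrow> real"
  assumes "sqint lborel F"
  shows "((LINT y|lborel. F y * indicator B y) / V)\<^sup>2 \<le> (LINT y|lborel. (F y)\<^sup>2) / V"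
  using sqint_Cauchy_Schwarz[OF assms sqint_indicator_cball, unfolded integral_indicator_cball] measure_cball_pos
  by (simp add: power_divide divide_le_eq power2_eq_square)

lemma ball_mean_bound:
  fixes f :: "'a \<Rightarrow> real"
  assumes "sqint lborel f"
  shows "(ball_mean \<delta> f x)\<^sup>2 \<le> (LINT y|lborel. (f y)\<^sup>2) / V"
  using mean_sq_le[OF sqint_translate(1)[OF assms, of x]] sqint_translate(2)[OF assms, of x]
  by (simp add: ball_mean_def B_def V_def)

text \<open>The difference of two averages is an average of increments of \<open>f\<close> by the
  fixed vector \<open>x - z\<close>; shifting the variable by \<open>z\<close> removes the base
  point, and the translation estimate becomes applicable.\<close>

lemma ball_mean_diff:
  fixes f :: "'a \<Rightarrow> real"
  assumes f: "sqint lborel f"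
  shows "(ball_mean \<delta> f x - ball_mean \<delta> f z)\<^sup>2 \<le> (LINT y|lborel. (f (y + (x - z)) - f y)\<^sup>2) / V"
proof -
  note i = sqint_inner_integrable[OF sqint_translate(1)[OF f] sqint_indicator_cball]
  let ?g = "\<lambda>y. f ((x - z) + y) - f y"
  have g: "sqint lborel ?g" by (intro sqint_diff sqint_translate f)
  have "ball_mean \<delta> f x - ball_mean \<delta> f z = (LINT y|lborel. (f (x + y) - f (z + y)) * indicator B y) / V"
    using i[of x] i[of z]
    by (simp add: ball_mean_def B_def V_def left_diff_distrib diff_divide_distrib)
  also have "\<dots>\<^sup>2 \<le> (LINT y|lborel. (f (x + y) - f (z + y))\<^sup>2) / V"
    by (intro mean_sq_le sqint_diff sqint_translate f)
  also have "(LINT y|lborel. (f (x + y) - f (z + y))\<^sup>2) = (LINT y|lborel. (norm (?g (z + y)))\<^sup>2)"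
    by (simp add: algebra_simps)
  also have "\<dots> = (LINT y|lborel. (f (y + (x - z)) - f y)\<^sup>2)"
    using sqint_translate(2)[OF g, of z] by (simp add: add.commute)
  finally show ?thesis .
qed

end

context
  fixes \<delta> :: real and \<Omega> :: "(real^'n::finite) set" and f :: "real^'n \<Rightarrow> real" and V :: real
  assumes \<delta>: "\<delta> > 0" and f: "test_fun \<Omega> f"
  defines "V \<equiv> measure lborel (cball (0::real^'n) \<delta>)"
begin

text \<open>The constant depends on \<open>f\<close> only through its gradient norm, so it is
  uniform along a sequence of bounded energy.\<close>

lemma ball_mean_lipschitz:
  "(ball_mean \<delta> f x - ball_mean \<delta> f z)\<^sup>2 \<le> (norm (x - z))\<^sup>2 * ((LINT y|lborel. (norm (grad f y))\<^sup>2) / V)"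
proof -
  have "(LINT y|lborel. (f (y + (x - z)) - f y)\<^sup>2) / V
      \<le> ((norm (x - z))\<^sup>2 * (LINT y|lborel. (norm (grad f y))\<^sup>2)) / V"
    using measure_cball_pos[OF \<delta>, where 'a = "real^'n"] by (intro divide_right_mono test_fun_translation[OF f]) (simp add: V_def)
  with ball_mean_diff[OF \<delta> sqint_test_fun(1)[OF f], of x z] show ?thesis by (simp add: V_def)
qed

lemma ball_mean_continuous: "continuous_on UNIV (ball_mean \<delta> f)"
proof -
  define L where "L = sqrt ((LINT y|lborel. (norm (grad f y))\<^sup>2) / V)"
  have "\<bar>ball_mean \<delta> f x - ball_mean \<delta> f z\<bar> \<le> L * norm (x - z)" for x z
    using real_sqrt_le_mono[OF ball_mean_lipschitz[of x z]] by (simp add: L_def real_sqrt_mult mult.commute del: times_divide_eq_right)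
  moreover have "L \<ge> 0"
    using measure_cball_pos[OF \<delta>, where 'a = "real^'n"]
    by (auto simp: L_def V_def intro!: divide_nonneg_pos integral_nonneg_AE)
  ultimately have "L-lipschitz_on UNIV (ball_mean \<delta> f)"
    by (auto simp: lipschitz_on_def dist_norm)
  then show ?thesis by (rule lipschitz_on_continuous_on)
qed

text \<open>Jensen's inequality for the average, then an exchange of integrals: each
  \<open>y\<close> in the ball contributes a translation by at most \<open>\<delta>\<close>, and the
  volume of the ball cancels the normalisation \<open>1 / V\<close>.\<close>

lemma ball_mean_approx_nn:
  "(\<integral>\<^sup>+x. ennreal ((ball_mean \<delta> f x - f x)\<^sup>2) \<partial>lborel)
    \<le> ennreal (\<delta>\<^sup>2 * (LINT y|lborel. (norm (grad f y))\<^sup>2))"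
proof -
  let ?I = "\<lambda>y. indicator (cball 0 \<delta>) y :: real"
  let ?g = "LINT y|lborel. (norm (grad f y))\<^sup>2"
  have V: "V > 0" using measure_cball_pos[OF \<delta>] by (simp add: V_def)
  have [measurable]: "cball (0::real^'n) \<delta> \<in> sets borel" by simp
  have g0: "?g \<ge> 0" by (intro integral_nonneg_AE) auto
  have c: "continuous_on S f" for S by (rule smooth_fun_continuous[OF test_fun_smooth[OF f]])
  then have [measurable]: "f \<in> borel_measurable borel" by (rule borel_measurable_continuous_onI)
  have "ennreal ((ball_mean \<delta> f x - f x)\<^sup>2)
      \<le> ennreal (1 / V) * (\<integral>\<^sup>+y. ennreal (?I y * (f (x + y) - f x)\<^sup>2) \<partial>lborel)" for x
  proof -
    let ?F = "\<lambda>y. (f (x + y) - f x) * ?I y"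
    have sq: "(norm (?F y))\<^sup>2 = ?I y *\<^sub>R (f (x + y) - f x)\<^sup>2" for y by (auto simp: indicator_def)
    have i: "integrable lborel (\<lambda>y. ?I y *\<^sub>R (f (x + y) - f x)\<^sup>2)"
      by (intro borel_integrable_compact continuous_intros continuous_on_compose2[OF c[of UNIV]]) auto
    have "?F \<in> borel_measurable lborel" by measurable
    then have F: "sqint lborel ?F" unfolding sqint_def sq using i by simp
    have "(LINT y|lborel. ?F y * ?I y) = (LINT y|lborel. f (x + y) * ?I y - f x * ?I y)"
      by (intro Bochner_Integration.integral_cong) (auto simp: indicator_def)
    also have "\<dots> = (LINT y|lborel. f (x + y) * ?I y) - f x * V"
      using sqint_inner_integrable[OF sqint_translate(1)[OF sqint_test_fun(1)[OF f]] sqint_indicator_cball[OF \<delta>], of x]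
        emeasure_lborel_cball_finite[of "0::real^'n" \<delta>]
      by (simp add: V_def)
    finally have "ball_mean \<delta> f x - f x = (LINT y|lborel. ?F y * ?I y) / V"
      using V by (simp add: ball_mean_def V_def diff_divide_distrib)
    then have "(ball_mean \<delta> f x - f x)\<^sup>2 \<le> (LINT y|lborel. (?F y)\<^sup>2) / V"
      using mean_sq_le[OF \<delta> F] by (simp add: V_def)
    also have "(LINT y|lborel. (?F y)\<^sup>2) = (LINT y|lborel. ?I y *\<^sub>R (f (x + y) - f x)\<^sup>2)"
      using sq by simp
    finally have "ennreal ((ball_mean \<delta> f x - f x)\<^sup>2) \<le> ennreal (1 / V * (LINT y|lborel. ?I y *\<^sub>R (f (x + y) - f x)\<^sup>2))"
      by (intro ennreal_leI) simp
    also have "\<dots> = ennreal (1 / V) * (\<integral>\<^sup>+y. ennreal (?I y *\<^sub>R (f (x + y) - f x)\<^sup>2) \<partial>lborel)"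
      using V by (subst nn_integral_eq_integral[OF i], simp, intro ennreal_mult integral_nonneg_AE) auto
    finally show ?thesis by simp
  qed
  then have "(\<integral>\<^sup>+x. ennreal ((ball_mean \<delta> f x - f x)\<^sup>2) \<partial>lborel)
      \<le> (\<integral>\<^sup>+x. ennreal (1 / V) * (\<integral>\<^sup>+y. ennreal (?I y * (f (x + y) - f x)\<^sup>2) \<partial>lborel) \<partial>lborel)"
    by (rule nn_integral_mono)
  also have "\<dots> = ennreal (1 / V) * (\<integral>\<^sup>+x. \<integral>\<^sup>+y. ennreal (?I y * (f (x + y) - f x)\<^sup>2) \<partial>lborel \<partial>lborel)"
    by (rule nn_integral_cmult) measurable
  also have "(\<integral>\<^sup>+x. \<integral>\<^sup>+y. ennreal (?I y * (f (x + y) - f x)\<^sup>2) \<partial>lborel \<partial>lborel)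
      = (\<integral>\<^sup>+y. \<integral>\<^sup>+x. ennreal (?I y * (f (x + y) - f x)\<^sup>2) \<partial>lborel \<partial>lborel)"
    by (rule lborel_pair.Fubini'[symmetric]) measurable
  also have "\<dots> \<le> (\<integral>\<^sup>+y. ennreal (\<delta>\<^sup>2 * ?g) * indicator (cball (0::real^'n) \<delta>) y \<partial>lborel)"
  proof (rule nn_integral_mono)
    fix y :: "real^'n"
    show "(\<integral>\<^sup>+x. ennreal (?I y * (f (x + y) - f x)\<^sup>2) \<partial>lborel) \<le> ennreal (\<delta>\<^sup>2 * ?g) * indicator (cball 0 \<delta>) y"
    proof (cases "y \<in> cball 0 \<delta>")
      case True
      have "(\<integral>\<^sup>+x. ennreal ((f (x + y) - f x)\<^sup>2) \<partial>lborel) \<le> ennreal ((norm y)\<^sup>2 * ?g)"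
        by (rule test_fun_translation_nn[OF f])
      also have "\<dots> \<le> ennreal (\<delta>\<^sup>2 * ?g)"
        using True g0 by (intro ennreal_leI mult_right_mono power_mono) auto
      finally show ?thesis using True by simp
    qed auto
  qed
  also have "\<dots> = ennreal (\<delta>\<^sup>2 * ?g) * ennreal V"
    using emeasure_lborel_cball_finite[of "0::real^'n" \<delta>]
    by (subst nn_integral_cmult) (auto simp: V_def emeasure_eq_ennreal_measure)
  also have "ennreal (1 / V) * (ennreal (\<delta>\<^sup>2 * ?g) * ennreal V) = ennreal (\<delta>\<^sup>2 * ?g)"
    using V g0 by (simp add: ennreal_mult[symmetric])
  finally show ?thesis by (simp add: mult_left_mono)
qed

lemma ball_mean_approx:
  "integrable lborel (\<lambda>x. (ball_mean \<delta> f x - f x)\<^sup>2)"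
  "(LINT x|lborel. (ball_mean \<delta> f x - f x)\<^sup>2) \<le> \<delta>\<^sup>2 * (LINT y|lborel. (norm (grad f y))\<^sup>2)"
proof -
  have [measurable]: "f \<in> borel_measurable borel" "ball_mean \<delta> f \<in> borel_measurable borel"
    using smooth_fun_continuous[OF test_fun_smooth[OF f]] ball_mean_continuous
    by (auto intro: borel_measurable_continuous_onI)
  show i: "integrable lborel (\<lambda>x. (ball_mean \<delta> f x - f x)\<^sup>2)"
    by (rule integrableI_nonneg) (use ball_mean_approx_nn in \<open>auto intro: le_less_trans\<close>)
  show "(LINT x|lborel. (ball_mean \<delta> f x - f x)\<^sup>2) \<le> \<delta>\<^sup>2 * (LINT y|lborel. (norm (grad f y))\<^sup>2)"
    using ball_mean_approx_nn nn_integral_eq_integral[OF i]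
    by (auto simp: ennreal_le_iff mult_nonneg_nonneg integral_nonneg_AE)
qed

end

text \<open>For one fixed radius \<open>\<delta>\<close> the averages converge uniformly along a
  subsequence and stay L^2-close to the functions. This gives precision \<open>\<epsilon>\<close>
  only; letting it tend to 0 is left to a diagonal argument.\<close>

lemma Rellich_almost_Cauchy:
  fixes \<Omega> :: "(real^'n::finite) set"
  assumes "bounded \<Omega>" and f: "\<And>k. test_fun \<Omega> (f k)"
    and bd: "\<And>k. (LINT x|lborel. (norm (grad (f k) x))\<^sup>2) \<le> C" and \<epsilon>: "\<epsilon> > 0"
  shows "\<exists>r::nat\<Rightarrow>nat. strict_mono r \<and> (\<forall>i j. (LINT x|lborel. (f (r i) x - f (r j) x)\<^sup>2) < \<epsilon>)"
proof -
  obtain P where P: "P > 0" "\<And>f. test_fun \<Omega> f \<Longrightarrow>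
      (LINT x|lborel. (f x)\<^sup>2) \<le> P * (LINT x|lborel. (norm (grad f x))\<^sup>2)"
    using Poincare_test_fun[OF assms(1)] by blast
  obtain R where "\<forall>x\<in>\<Omega>. norm x \<le> R" using assms(1) unfolding bounded_iff ..
  then have R: "\<Omega> \<subseteq> cball 0 R" by auto
  have [measurable]: "cball (0::real^'n) R \<in> sets borel" by simp
  have C0: "C \<ge> 0" using bd[of 0] by (rule order_trans[rotated]) (intro integral_nonneg_AE, auto)
  \<comment> \<open>Makes the two averaging errors together, \<open>6 * \<delta>^2 * C\<close>, less
    than half of \<open>\<epsilon>\<close>; \<open>\<eta>\<close> below does the same for the
    uniform error \<open>12 * m * \<eta>^2\<close>. The summands 1 avoid division by zero.\<close>
  define \<delta> where "\<delta> = sqrt (\<epsilon> / (12 * (C + 1)))"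
  have \<delta>: "\<delta> > 0" "6 * \<delta>\<^sup>2 * C < \<epsilon> / 2"
    using \<epsilon> C0 by (auto simp: \<delta>_def field_simps)
  define m where "m = measure lborel (cball (0::real^'n) R)"
  define \<eta> where "\<eta> = sqrt (\<epsilon> / (24 * (m + 1)))"
  have m0: "m \<ge> 0" by (simp add: m_def)
  have \<eta>: "\<eta> > 0" "12 * m * \<eta>\<^sup>2 < \<epsilon> / 2"
    using \<epsilon> m0 by (auto simp: \<eta>_def field_simps)
  let ?A = "\<lambda>k. ball_mean \<delta> (f k)"
  define V where "V = measure lborel (cball (0::real^'n) \<delta>)"
  have V: "V > 0" using measure_cball_pos[OF \<delta>(1)] by (simp add: V_def)
  obtain g k where k: "strict_mono (k :: nat \<Rightarrow> nat)"
    and g: "\<And>e. 0 < e \<Longrightarrow> \<exists>N. \<forall>n x. n \<ge> N \<and> x \<in> cball 0 R \<longrightarrow> norm (?A (k n) x - g x) < e"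
  proof (rule Arzela_Ascoli[of "cball 0 R" ?A "sqrt (P * C / V)"])
    fix n x
    have "(?A n x)\<^sup>2 \<le> (LINT y|lborel. (f n y)\<^sup>2) / V"
      unfolding V_def by (rule ball_mean_bound[OF \<delta>(1) sqint_test_fun(1)[OF f]])
    also have "\<dots> \<le> P * C / V"
      using order_trans[OF P(2)[OF f] mult_left_mono[OF bd]] P(1) V by (intro divide_right_mono) auto
    finally show "norm (?A n x) \<le> sqrt (P * C / V)" by (simp add: real_le_rsqrt)
  next
    fix x :: "real^'n" and e :: real assume e: "0 < e"
    define L where "L = sqrt (C / V)"
    have L: "norm (?A n x - ?A n y) \<le> norm (x - y) * L" for n y
    proof -
      have "(?A n x - ?A n y)\<^sup>2 \<le> (norm (x - y))\<^sup>2 * (C / V)"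
        using order_trans[OF ball_mean_lipschitz[OF \<delta>(1) f]
            mult_left_mono[OF divide_right_mono[OF bd], OF less_imp_le[OF V[unfolded V_def]] zero_le_power2]]
        unfolding V_def .
      then have "sqrt ((?A n x - ?A n y)\<^sup>2) \<le> sqrt ((norm (x - y))\<^sup>2 * (C / V))" by (rule real_sqrt_le_mono)
      also have "\<dots> = norm (x - y) * L" unfolding L_def real_sqrt_mult by simp
      finally show ?thesis by simp
    qed
    have L0: "L \<ge> 0" using C0 V by (simp add: L_def)
    show "\<exists>d>0. \<forall>n y. y \<in> cball 0 R \<and> norm (x - y) < d \<longrightarrow> norm (?A n x - ?A n y) < e"
    proof (intro exI conjI allI impI)
      show "0 < e / (L + 1)" using e L0 by simp
      fix n y assume "y \<in> cball 0 R \<and> norm (x - y) < e / (L + 1)"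
      then have "norm (x - y) * (L + 1) < e" using L0 by (simp add: field_simps)
      moreover have "norm (x - y) * L \<le> norm (x - y) * (L + 1)" by (intro mult_left_mono) auto
      ultimately show "norm (?A n x - ?A n y) < e" using L[of n y] by linarith
    qed
  qed (auto intro: that)
  obtain N where N: "\<And>n x. n \<ge> N \<Longrightarrow> x \<in> cball 0 R \<Longrightarrow> \<bar>?A (k n) x - g x\<bar> < \<eta>"
    using g[OF \<eta>(1)] by auto
  \<comment> \<open>Dropping the first \<open>N\<close> terms gives the bound for all pairs of
    indices, a property that passes to every further subsequence.\<close>
  define r where "r n = k (N + n)" for n
  have "strict_mono r" using k by (auto simp: r_def strict_mono_def)
  moreover have "(LINT x|lborel. (f (r i) x - f (r j) x)\<^sup>2) < \<epsilon>" for i j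
  proof -
    let ?D = "\<lambda>i x. (?A (r i) x - f (r i) x)\<^sup>2"
    let ?U = "\<lambda>x. 3 * ?D i x + 3 * ?D j x + 12 * \<eta>\<^sup>2 * indicator (cball 0 R) x"
    have D: "integrable lborel (?D i)" "(LINT x|lborel. ?D i x) \<le> \<delta>\<^sup>2 * C" for i
      using ball_mean_approx[OF \<delta>(1) f] mult_left_mono[OF bd[of "r i"], of "\<delta>\<^sup>2"]
      by (auto intro: order_trans)
    have I: "integrable lborel (indicator (cball (0::real^'n) R) :: _ \<Rightarrow> real)"
      using emeasure_lborel_cball_finite[of "0::real^'n" R] by simp
    \<comment> \<open>On the ball, \<open>(a + b + c)^2 \<le> 3 * (a^2 + b^2 + c^2)\<close>, and
      \<open>c\<close> is at most \<open>2 * \<eta>\<close> in absolute value. Off the ball both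
      functions vanish, though their averages need not, so the uniform estimate is used on the ball
      only.\<close>
    have le: "(f (r i) x - f (r j) x)\<^sup>2 \<le> ?U x" for x
    proof (cases "x \<in> cball 0 R")
      case True
      define a b c where "a = f (r i) x - ?A (r i) x" and "b = ?A (r j) x - f (r j) x"
        and "c = ?A (r i) x - ?A (r j) x"
      have "\<bar>c\<bar> \<le> 2 * \<eta>" using N[OF _ True, of "N + i"] N[OF _ True, of "N + j"] by (simp add: c_def r_def)
      then have c: "c\<^sup>2 \<le> 4 * \<eta>\<^sup>2" using power_mono[of "\<bar>c\<bar>" "2 * \<eta>" 2] by (simp add: power_mult_distrib)
      have "(f (r i) x - f (r j) x)\<^sup>2 = (a + b + c)\<^sup>2" by (simp add: a_def b_def c_def)
      also have "\<dots> \<le> 3 * a\<^sup>2 + 3 * b\<^sup>2 + 3 * c\<^sup>2"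
        using sum_squares_bound[of a b] sum_squares_bound[of b c] sum_squares_bound[of a c]
        by (simp add: power2_eq_square algebra_simps)
      also have "\<dots> \<le> ?U x" using c True by (simp add: a_def b_def power2_commute)
      finally show ?thesis .
    next
      case False
      then have "x \<notin> \<Omega>" using R by auto
      then show ?thesis using test_fun_outside(1)[OF f] by simp
    qed
    have "(LINT x|lborel. (f (r i) x - f (r j) x)\<^sup>2) \<le> (LINT x|lborel. ?U x)"
      using sqint_integrable[OF sqint_diff[OF sqint_test_fun(1)[OF f] sqint_test_fun(1)[OF f]]] D I le
      by (intro integral_mono Bochner_Integration.integrable_add Bochner_Integration.integrable_mult_right) simp_all
    also have "\<dots> = 3 * (LINT x|lborel. ?D i x) + 3 * (LINT x|lborel. ?D j x) + 12 * \<eta>\<^sup>2 * m"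
      using D I by (simp add: m_def)
    also have "\<dots> < \<epsilon>" using D(2)[of i] D(2)[of j] \<delta>(2) \<eta>(2) by (simp add: mult_ac)
    finally show ?thesis .
  qed
  ultimately show ?thesis by blast
qed

text \<open>Diagonal argument: \<open>P n\<close> records precision \<open>1 / Suc n\<close> and is
  inherited by subsequences.\<close>

lemma Rellich_test_fun:
  fixes \<Omega> :: "(real^'n::finite) set"
  assumes "bounded \<Omega>" and f: "\<And>k. test_fun \<Omega> (f k)"
    and bd: "\<And>k. (LINT x|lborel. (norm (grad (f k) x))\<^sup>2) \<le> C"
  obtains r :: "nat \<Rightarrow> nat" where "strict_mono r"
    "\<forall>e>0. \<exists>N. \<forall>i\<ge>N. \<forall>j\<ge>N. (LINT x|lborel. (f (r i) x - f (r j) x)\<^sup>2) < e"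
proof -
  define P where "P n s \<longleftrightarrow> (\<forall>i j. (LINT x|lborel. (f (s i) x - f (s j) x)\<^sup>2) < 1 / real (Suc n))"
    for n and s :: "nat \<Rightarrow> nat"
  interpret subseqs P
  proof
    fix n and s :: "nat \<Rightarrow> nat"
    show "\<exists>r'. strict_mono r' \<and> P n (s \<circ> r')"
      using Rellich_almost_Cauchy[OF assms(1), of "\<lambda>k. f (s k)" C "1 / real (Suc n)"] f bd
      by (simp add: P_def o_def)
  qed
  \<comment> \<open>From index \<open>Suc n\<close> on, the diagonal sequence is a subsequence of
    the one selected for \<open>P n\<close>.\<close>
  have d: "P n (diagseq \<circ> (+) (Suc n))" for n
    by (rule diagseq_holds) (simp add: P_def)
  show ?thesis
  proof (rule that[OF subseq_diagseq], intro allI impI)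
    fix e :: real assume "e > 0"
    then obtain n where n: "1 / real (Suc n) < e" using nat_approx_posE by blast
    show "\<exists>N. \<forall>i\<ge>N. \<forall>j\<ge>N. (LINT x|lborel. (f (diagseq i) x - f (diagseq j) x)\<^sup>2) < e"
    proof (intro exI allI impI)
      fix i j assume "Suc n \<le> i" "Suc n \<le> j"
      then obtain i' j' where ij: "i = Suc n + i'" "j = Suc n + j'" using le_Suc_ex by blast
      have "(LINT x|lborel. (f (diagseq i) x - f (diagseq j) x)\<^sup>2) < 1 / real (Suc n)"
        using d[of n] unfolding P_def ij o_def by blast
      then show "(LINT x|lborel. (f (diagseq i) x - f (diagseq j) x)\<^sup>2) < e" using n by linarith
    qed
  qed
qed

section \<open>The first eigenvalue\<close>

lemma H01_iff:
  fixes \<Omega> :: "(real^'n::finite) set"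
  assumes "\<Omega> \<in> sets lebesgue"
  shows "H01 \<Omega> u g \<longleftrightarrow> sqint (lebesgue_on \<Omega>) u \<and> sqint (lebesgue_on \<Omega>) g \<and>
     (\<exists>\<phi>. (\<forall>k::nat. test_fun \<Omega> (\<phi> k)) \<and>
        (\<lambda>k. LINT x|lebesgue_on \<Omega>. (norm (\<phi> k x - u x))\<^sup>2) \<longlonglongrightarrow> 0 \<and>
        (\<lambda>k. LINT x|lebesgue_on \<Omega>. (norm (grad (\<phi> k) x - g x))\<^sup>2) \<longlonglongrightarrow> 0)"
  using assms
  by (simp add: H01_def sqint_def set_borel_measurable_def set_integrable_def set_lebesgue_integral_def
      borel_measurable_restrict_space_iff integrable_restrict_space integral_restrict_space conj_ac)

lemma set_integral_lebesgue_on: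
  fixes f :: "'a::euclidean_space \<Rightarrow> real"
  shows "\<Omega> \<in> sets lebesgue \<Longrightarrow> (LINT x:\<Omega>|lebesgue. f x) = (LINT x|lebesgue_on \<Omega>. f x)"
  by (simp add: set_lebesgue_integral_def integral_restrict_space)

text \<open>Makes the estimates on the whole space, where translations act, available on
  \<open>\<Omega>\<close>.\<close>

lemma lebesgue_on_eq_lborel:
  fixes h :: "'a::euclidean_space \<Rightarrow> 'b::{banach, second_countable_topology}"
  assumes "\<Omega> \<in> sets lebesgue" "h \<in> borel_measurable borel" "\<And>x. x \<notin> \<Omega> \<Longrightarrow> h x = 0"
  shows "integrable (lebesgue_on \<Omega>) h \<longleftrightarrow> integrable lborel h"
    and "(LINT x|lebesgue_on \<Omega>. h x) = (LINT x|lborel. h x)"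
proof -
  have "(\<lambda>x. indicator \<Omega> x *\<^sub>R h x) = h" using assms(3) by (auto simp: indicator_def fun_eq_iff)
  then show "integrable (lebesgue_on \<Omega>) h \<longleftrightarrow> integrable lborel h"
    "(LINT x|lebesgue_on \<Omega>. h x) = (LINT x|lborel. h x)"
    using assms(1,2)
    by (simp_all add: integrable_restrict_space integral_restrict_space integrable_completion integral_completion)
qed

lemma test_fun_lebesgue_on:
  fixes \<Omega> :: "(real^'n::finite) set"
  assumes "\<Omega> \<in> sets lebesgue" "test_fun \<Omega> f"
  shows "sqint (lebesgue_on \<Omega>) f" "sqint (lebesgue_on \<Omega>) (grad f)"
    and "(LINT x|lebesgue_on \<Omega>. (norm (f x))\<^sup>2) = (LINT x|lborel. (norm (f x))\<^sup>2)"
    and "(LINT x|lebesgue_on \<Omega>. (norm (grad f x))\<^sup>2) = (LINT x|lborel. (norm (grad f x))\<^sup>2)"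
proof -
  have [measurable]: "f \<in> borel_measurable borel" "grad f \<in> borel_measurable borel"
    using sqint_test_fun[OF assms(2), THEN sqint_measurable] by auto
  have [measurable]: "f \<in> borel_measurable (lebesgue_on \<Omega>)" "grad f \<in> borel_measurable (lebesgue_on \<Omega>)"
    by (auto intro!: measurable_restrict_space1 measurable_completion)
  note z = test_fun_outside[OF assms(2)]
  have 1: "(\<lambda>x. (norm (f x))\<^sup>2) \<in> borel_measurable borel" "\<And>x. x \<notin> \<Omega> \<Longrightarrow> (norm (f x))\<^sup>2 = 0"
    using z by auto
  have 2: "(\<lambda>x. (norm (grad f x))\<^sup>2) \<in> borel_measurable borel" "\<And>x. x \<notin> \<Omega> \<Longrightarrow> (norm (grad f x))\<^sup>2 = 0"
    using z by auto
  note e1 = lebesgue_on_eq_lborel[OF assms(1) 1] and e2 = lebesgue_on_eq_lborel[OF assms(1) 2]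
  show "sqint (lebesgue_on \<Omega>) f" "sqint (lebesgue_on \<Omega>) (grad f)"
    using sqint_test_fun[OF assms(2), THEN sqint_integrable] e1(1) e2(1) unfolding sqint_def by auto
  show "(LINT x|lebesgue_on \<Omega>. (norm (f x))\<^sup>2) = (LINT x|lborel. (norm (f x))\<^sup>2)"
    "(LINT x|lebesgue_on \<Omega>. (norm (grad f x))\<^sup>2) = (LINT x|lborel. (norm (grad f x))\<^sup>2)"
    using e1(2) e2(2) by auto
qed

lemma H01_test_fun:
  assumes "\<Omega> \<in> sets lebesgue" "test_fun \<Omega> f"
  shows "H01 \<Omega> f (grad f)"
  unfolding H01_iff[OF assms(1)]
  using test_fun_lebesgue_on[OF assms] assms(2) by (auto intro!: exI[of _ "\<lambda>_. f"])

lemma Lnorm_nonneg: "0 \<le> Lnorm \<Omega> r u"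
  by (simp add: Lnorm_def)

lemma Lnorm_2_sq:
  assumes "\<Omega> \<in> sets lebesgue"
  shows "(Lnorm \<Omega> 2 u)\<^sup>2 = (LINT x|lebesgue_on \<Omega>. (norm (u x))\<^sup>2)"
proof -
  have "0 \<le> (LINT x|lebesgue_on \<Omega>. \<bar>u x\<bar>\<^sup>2)" by (intro integral_nonneg_AE) auto
  then show ?thesis
    by (simp add: Lnorm_def set_integral_lebesgue_on[OF assms] powr_half_sqrt)
qed

section \<open>The Rayleigh quotient on a bounded open set\<close>

locale bounded_open =
  fixes \<Omega> :: "(real^'n::finite) set"
  assumes op: "open \<Omega>" and bdd: "bounded \<Omega>" and ne: "\<Omega> \<noteq> {}"
begin

abbreviation "M \<equiv> lebesgue_on \<Omega>"

lemma meas: "\<Omega> \<in> sets lebesgue"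
  using op by simp

lemma finite_M: "finite_measure M"
  by (intro finite_measure_lebesgue_on) (use op bdd in \<open>simp add: lmeasurable_open\<close>)

lemma sqint_test: "test_fun \<Omega> f \<Longrightarrow> sqint M f" "test_fun \<Omega> f \<Longrightarrow> sqint M (grad f)"
  using test_fun_lebesgue_on[OF meas] by auto

definition mass :: "(real^'n \<Rightarrow> real) \<Rightarrow> real" where
  "mass f = (LINT x|M. (norm (f x))\<^sup>2)"

definition energy :: "(real^'n \<Rightarrow> real) \<Rightarrow> real" where
  "energy f = (LINT x|M. (norm (grad f x))\<^sup>2)"

lemma mass_nonneg: "0 \<le> mass f" and energy_nonneg: "0 \<le> energy f"
  unfolding mass_def energy_def by (auto intro: integral_nonneg_AE)

lemma mass_lincomb:
  assumes "test_fun \<Omega> f" "test_fun \<Omega> h"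
  shows "mass (\<lambda>x. f x + c * h x) = mass f + 2 * c * (LINT x|M. f x \<bullet> h x) + c\<^sup>2 * mass h"
  using sqint_lincomb(2)[OF sqint_test(1)[OF assms(1)] sqint_test(1)[OF assms(2)], of c]
  by (simp add: mass_def)

lemma energy_lincomb:
  assumes "test_fun \<Omega> f" "test_fun \<Omega> h"
  shows "energy (\<lambda>x. f x + c * h x) = energy f + 2 * c * (LINT x|M. grad f x \<bullet> grad h x) + c\<^sup>2 * energy h"
  using sqint_lincomb(2)[OF sqint_test(2)[OF assms(1)] sqint_test(2)[OF assms(2)], of c]
    grad_lincomb[OF test_fun_smooth[OF assms(1)] test_fun_smooth[OF assms(2)]]
  by (simp add: energy_def)

lemma mass_cmult: "mass (\<lambda>x. c * f x) = c\<^sup>2 * mass f"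
  by (simp add: mass_def power_mult_distrib)

lemma energy_cmult: "test_fun \<Omega> f \<Longrightarrow> energy (\<lambda>x. c * f x) = c\<^sup>2 * energy f"
  by (simp add: energy_def grad_cmult test_fun_smooth power_mult_distrib)

lemma Poincare:
  obtains C where "C > 0" "\<And>f. test_fun \<Omega> f \<Longrightarrow> mass f \<le> C * energy f"
proof -
  obtain C where "C > 0" "\<And>f. test_fun \<Omega> f \<Longrightarrow>
      (LINT x|lborel. (f x)\<^sup>2) \<le> C * (LINT x|lborel. (norm (grad f x))\<^sup>2)"
    using Poincare_test_fun[OF bdd] by blast
  with that[of C] show ?thesis
    using test_fun_lebesgue_on[OF meas] by (simp add: mass_def energy_def)
qed

text \<open>A vanishing integral would make the nonempty open set \<open>{x. f x \<noteq> 0}\<close>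
  a null set.\<close>

lemma Lnorm_test_fun_pos:
  assumes f: "test_fun \<Omega> f" and x0: "f x0 \<noteq> 0" and r: "r > 0"
  shows "Lnorm \<Omega> r f > 0"
proof -
  let ?h = "\<lambda>x. \<bar>f x\<bar> powr r"
  have c: "continuous_on UNIV f" by (rule smooth_fun_continuous[OF test_fun_smooth[OF f]])
  have ch: "continuous_on UNIV ?h"
    using r by (intro continuous_on_powr' continuous_on_rabs c continuous_on_const) auto
  have z: "?h x = 0" if "x \<notin> closure {x. f x \<noteq> 0}" for x
    using that closure_subset[of "{x. f x \<noteq> 0}"] by auto
  have i: "integrable lborel ?h"
    by (rule integrable_continuous_compact_support[OF ch _ z]) (use f in \<open>auto simp only: test_fun_def\<close>)
  have "(LINT x|lborel. ?h x) \<noteq> 0"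
  proof
    assume "(LINT x|lborel. ?h x) = 0"
    then have "AE x in lborel. f x = 0"
      using integral_nonneg_eq_0_iff_AE[OF i] by simp
    then have "emeasure lborel {x. f x \<noteq> 0} = 0"
      using AE_iff_measurable[of "{x. f x \<noteq> 0}" lborel "\<lambda>x. f x = 0"]
        borel_measurable_continuous_onI[OF c] by simp
    moreover have o: "open {x. f x \<noteq> 0}" by (intro open_Collect_neq c continuous_on_const)
    ultimately have "{x. f x \<noteq> 0} \<in> null_sets lebesgue"
      by (intro null_sets_completionI) (simp add: null_sets_def)
    then have "{x. f x \<noteq> 0} = {}"
      using open_not_negligible[OF o] by (auto simp: negligible_iff_null_sets)
    then show False using x0 by auto
  qed
  moreover have "(LINT x:\<Omega>|lebesgue. ?h x) = (LINT x|lborel. ?h x)"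
    unfolding set_integral_lebesgue_on[OF meas]
    using test_fun_outside(1)[OF f] by (intro lebesgue_on_eq_lborel meas borel_measurable_continuous_onI ch) auto
  ultimately show ?thesis by (simp add: Lnorm_def)
qed

lemma bump:
  obtains f where "test_fun \<Omega> f" "\<And>r. r > 0 \<Longrightarrow> Lnorm \<Omega> r f > 0" "mass f > 0" "energy f > 0"
proof -
  obtain f x0 where f: "test_fun \<Omega> f" "f x0 \<noteq> 0"
    using test_fun_exists[OF op ne] by blast
  note L = Lnorm_test_fun_pos[OF f]
  have m: "mass f > 0"
    using L[of 2] unfolding mass_def Lnorm_2_sq[OF meas, symmetric] by simp
  \<comment> \<open>Poincare's inequality turns positive mass into positive energy.\<close>
  obtain C where "C > 0" "mass f \<le> C * energy f" using Poincare f(1) by blast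
  then have "energy f > 0" using m by (metis less_le_trans zero_less_mult_pos)
  with f(1) L m that show ?thesis by blast
qed

text \<open>\<open>l\<close> is the infimum of the Rayleigh quotient over test functions. A
  minimising sequence converges in L^2 together with its gradients, so its limit lies in H_0^1 by
  the very definition of that space; the eigenvalue equation is the vanishing first
  variation.\<close>

lemma eigenfunction:
  obtains l u g where "l > 0" "\<And>f. test_fun \<Omega> f \<Longrightarrow> l * mass f \<le> energy f"
    "H01 \<Omega> u g" "(LINT x|M. (norm (u x))\<^sup>2) = 1"
    "\<And>\<phi>. test_fun \<Omega> \<phi> \<Longrightarrow> (LINT x|M. g x \<bullet> grad \<phi> x) = l * (LINT x|M. u x \<bullet> \<phi> x)"
proof -
  define E where "E = {energy f | f. test_fun \<Omega> f \<and> mass f = 1}"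
  define l where "l = Inf E"
  have normalize: "energy f / mass f \<in> E" if "test_fun \<Omega> f" "mass f > 0" for f
  proof -
    let ?h = "\<lambda>x. (1 / sqrt (mass f)) * f x"
    have "test_fun \<Omega> ?h" "mass ?h = 1" "energy ?h = energy f / mass f"
      using that test_fun_cmult[OF that(1)] by (auto simp only: mass_cmult energy_cmult)
        (simp_all add: power_divide)
    then show ?thesis unfolding E_def by (metis (mono_tags, lifting) mem_Collect_eq)
  qed
  obtain b where "test_fun \<Omega> b" "mass b > 0" using bump by blast
  then have Ene: "E \<noteq> {}" using normalize by blast
  have bb: "bdd_below E" using energy_nonneg by (intro bdd_belowI[of _ 0]) (auto simp: E_def)
  obtain C where C: "C > 0" "\<And>f. test_fun \<Omega> f \<Longrightarrow> mass f \<le> C * energy f" using Poincare by blast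
  \<comment> \<open>The Poincare constant keeps the infimum away from 0.\<close>
  have "1 / C \<le> l" unfolding l_def
    by (rule cInf_greatest[OF Ene]) (use C in \<open>auto simp: E_def field_simps dest!: C(2)\<close>)
  then have l: "l > 0" using C(1) by (smt (verit) divide_pos_pos)
  have ray: "l * mass f \<le> energy f" if f: "test_fun \<Omega> f" for f
  proof (cases "mass f = 0")
    case True
    then show ?thesis by (simp add: energy_nonneg)
  next
    case False
    then have m: "mass f > 0" using mass_nonneg[of f] by simp
    have "l \<le> energy f / mass f"
      unfolding l_def by (rule cInf_lower[OF normalize[OF f m] bb])
    then show ?thesis using m by (simp add: field_simps)
  qed
  have "\<exists>f. test_fun \<Omega> f \<and> mass f = 1 \<and> energy f < l + 1 / real (Suc n)" for n
  proof -
    obtain y where "y \<in> E" "y < l + 1 / real (Suc n)"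
      using cInf_lessD[OF Ene, of "l + 1 / real (Suc n)"] by (auto simp: l_def)
    then show ?thesis by (auto simp: E_def)
  qed
  then obtain F where F: "\<And>n. test_fun \<Omega> (F n)" "\<And>n. mass (F n) = 1"
      "\<And>n. energy (F n) < l + 1 / real (Suc n)" by metis
  have bd: "(LINT x|lborel. (norm (grad (F k) x))\<^sup>2) \<le> l + 1" for k
  proof -
    have "1 / real (Suc k) \<le> 1" by simp
    with F(3)[of k] show ?thesis
      unfolding energy_def test_fun_lebesgue_on(4)[OF meas F(1)] by linarith
  qed
  obtain r :: "nat \<Rightarrow> nat" where r: "strict_mono r"
    "\<forall>e>0. \<exists>N. \<forall>i\<ge>N. \<forall>j\<ge>N. (LINT x|lborel. (F (r i) x - F (r j) x)\<^sup>2) < e"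
    by (rule Rellich_test_fun[where f = F, OF bdd F(1) bd])
  define f where "f n = F (r n)" for n
  have f: "test_fun \<Omega> (f n)" "mass (f n) = 1" for n using F by (auto simp: f_def)
  have "energy (f n) \<le> l + 1 / real (Suc n)" for n
  proof -
    have "1 / real (Suc (r n)) \<le> 1 / real (Suc n)"
      using seq_suble[OF r(1), of n] by (simp add: frac_le)
    then show ?thesis using F(3)[of "r n"] by (simp add: f_def)
  qed
  then have en: "(\<lambda>n. energy (f n)) \<longlonglongrightarrow> l"
  proof (intro tendsto_sandwich[of "\<lambda>_. l" "\<lambda>n. energy (f n)" sequentially "\<lambda>n. l + 1 / real (Suc n)"])
    show "\<forall>\<^sub>F n in sequentially. l \<le> energy (f n)" using ray[OF f(1)] f(2) by simp
    show "(\<lambda>n. l + 1 / real (Suc n)) \<longlonglongrightarrow> l"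
      using tendsto_add[OF tendsto_const[of l] LIMSEQ_inverse_real_of_nat] by (simp add: inverse_eq_divide)
  qed auto
  define d where "d i j = (\<lambda>x. f i x + (-1) * f j x)" for i j
  have tf: "test_fun \<Omega> (d i j)" for i j unfolding d_def by (intro test_fun_lincomb f)
  have massd: "mass (d i j) = (LINT x|M. (norm (f i x - f j x))\<^sup>2)" for i j
    by (simp add: mass_def d_def)
  have energyd: "energy (d i j) = (LINT x|M. (norm (grad (f i) x - grad (f j) x))\<^sup>2)" for i j
    unfolding energy_def d_def using grad_lincomb[OF test_fun_smooth[OF f(1)] test_fun_smooth[OF f(1)], of i "-1" j]
    by simp
  have cm: "\<exists>N. \<forall>i\<ge>N. \<forall>j\<ge>N. mass (d i j) < e" if "e > 0" for e
  proof -
    have "mass (d i j) = (LINT x|lborel. (F (r i) x - F (r j) x)\<^sup>2)" for i j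
      using test_fun_lebesgue_on(3)[OF meas tf[of i j]] by (simp add: mass_def d_def f_def)
    then show ?thesis using r(2) that by simp
  qed
  \<comment> \<open>The masses of the sum \<open>s\<close> and the difference \<open>d i j\<close>
    add up to 4. As \<open>energy s\<close> is at least \<open>l * mass s\<close>, little energy is
    left for the difference.\<close>
  have par: "energy (d i j) \<le> 2 * (energy (f i) - l) + 2 * (energy (f j) - l) + l * mass (d i j)" for i j
  proof -
    define s where "s = (\<lambda>x. f i x + 1 * f j x)"
    have "l * mass s \<le> energy s" unfolding s_def by (intro ray test_fun_lincomb f)
    moreover have "energy s + energy (d i j) = 2 * energy (f i) + 2 * energy (f j)"
      unfolding d_def s_def energy_lincomb[OF f(1) f(1)] by simp
    moreover have "mass s + mass (d i j) = 4"
      unfolding d_def s_def mass_lincomb[OF f(1) f(1)] using f(2) by simp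
    then have "l * mass s = 4 * l - l * mass (d i j)" by (simp add: algebra_simps flip: distrib_left)
    ultimately show ?thesis by (simp add: algebra_simps)
  qed
  have ce: "\<exists>N. \<forall>i\<ge>N. \<forall>j\<ge>N. energy (d i j) < e" if e: "e > 0" for e
  proof -
    \<comment> \<open>In \<open>par\<close> the three terms then stay below \<open>e / 4\<close>,
      \<open>e / 4\<close> and \<open>e / 2\<close>.\<close>
    obtain N1 where N1: "\<forall>i\<ge>N1. \<forall>j\<ge>N1. mass (d i j) < e / (2 * l)" using cm[of "e / (2 * l)"] e l by auto
    obtain N2 where N2: "\<forall>i\<ge>N2. energy (f i) < l + e / 8"
      using order_tendstoD(2)[OF en, of "l + e / 8"] e by (auto simp: eventually_sequentially)
    show ?thesis
    proof (intro exI allI impI)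
      fix i j assume ij: "i \<ge> max N1 N2" "j \<ge> max N1 N2"
      then have "l * mass (d i j) < e / 2" using N1 l by (auto simp: field_simps)
      moreover have "energy (f i) < l + e / 8" "energy (f j) < l + e / 8" using ij N2 by auto
      ultimately show "energy (d i j) < e" using par[of i j] by (simp add: algebra_simps)
    qed
  qed
  obtain u where u: "sqint M u" "(\<lambda>k. LINT x|M. (norm (f k x - u x))\<^sup>2) \<longlonglongrightarrow> 0"
    by (rule sqint_complete[where f = f, OF finite_M sqint_test(1)[OF f(1)] cm[unfolded massd]])
  obtain g where g: "sqint M g" "(\<lambda>k. LINT x|M. (norm (grad (f k) x - g x))\<^sup>2) \<longlonglongrightarrow> 0"
    by (rule sqint_complete[where f = "\<lambda>k. grad (f k)", OF finite_M sqint_test(2)[OF f(1)] ce[unfolded energyd]])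
  show ?thesis
  proof (rule that[OF l ray])
    show "H01 \<Omega> u g" unfolding H01_iff[OF meas] using u g f by blast
    show "(LINT x|M. (norm (u x))\<^sup>2) = 1"
      using sqint_limit_norm[OF sqint_test(1)[OF f(1)] u] f(2) by (simp add: mass_def LIMSEQ_const_iff)
    fix \<phi> assume \<phi>: "test_fun \<Omega> \<phi>"
    define q where "q = energy \<phi> - l * mass \<phi>"
    define b where "b = (LINT x|M. g x \<bullet> grad \<phi> x) - l * (LINT x|M. u x \<bullet> \<phi> x)"
    have q: "q \<ge> 0" using ray[OF \<phi>] by (simp add: q_def)
    have lim: "(\<lambda>k. LINT x|M. f k x \<bullet> \<phi> x) \<longlonglongrightarrow> (LINT x|M. u x \<bullet> \<phi> x)"
      "(\<lambda>k. LINT x|M. grad (f k) x \<bullet> grad \<phi> x) \<longlonglongrightarrow> (LINT x|M. g x \<bullet> grad \<phi> x)"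
      by (rule sqint_limit_inner sqint_test f u g \<phi>)+
    \<comment> \<open>The Rayleigh inequality for \<open>f k + t * \<phi>\<close>, passed to the
      limit in \<open>k\<close>. The constant term tends to \<open>l - l = 0\<close>, and a
      nonnegative quadratic without constant term has no linear term.\<close>
    have "0 \<le> 2 * t * b + t\<^sup>2 * q" for t
    proof -
      have "0 \<le> energy (f k) - l + 2 * t * ((LINT x|M. grad (f k) x \<bullet> grad \<phi> x) - l * (LINT x|M. f k x \<bullet> \<phi> x)) + t\<^sup>2 * q" for k
        using ray[OF test_fun_lincomb[OF f(1) \<phi>], of k t] f(2)[of k]
        by (simp add: mass_lincomb[OF f(1) \<phi>] energy_lincomb[OF f(1) \<phi>] q_def algebra_simps)
      moreover have "(\<lambda>k. energy (f k) - l + 2 * t * ((LINT x|M. grad (f k) x \<bullet> grad \<phi> x) - l * (LINT x|M. f k x \<bullet> \<phi> x)) + t\<^sup>2 * q)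
          \<longlonglongrightarrow> l - l + 2 * t * b + t\<^sup>2 * q"
        unfolding b_def by (intro tendsto_intros en lim)
      ultimately have "0 \<le> l - l + 2 * t * b + t\<^sup>2 * q" by (intro LIMSEQ_le_const) auto
      then show ?thesis by simp
    qed
    \<comment> \<open>\<open>q + 1\<close> is positive even when \<open>q = 0\<close>; clearing this
      denominator leaves \<open>0 \<le> - (b^2 * (q + 2))\<close>.\<close>
    from this[of "- b / (q + 1)"] have "0 \<le> (2 * (- b / (q + 1)) * b + (- b / (q + 1))\<^sup>2 * q) * (q + 1)\<^sup>2"
      by simp
    also have "\<dots> = 2 * (- b / (q + 1) * (q + 1)) * b * (q + 1) + (- b / (q + 1) * (q + 1))\<^sup>2 * q"
      by (simp only: power_mult_distrib) (simp only: power2_eq_square algebra_simps)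
    also have "- b / (q + 1) * (q + 1) = - b" using q by simp
    also have "2 * (- b) * b * (q + 1) + (- b)\<^sup>2 * q = - (b\<^sup>2 * (q + 2))"
      by (simp add: algebra_simps power2_eq_square)
    finally have "b\<^sup>2 * (q + 2) \<le> 0" by simp
    then have "b = 0" using q by (simp add: mult_le_0_iff)
    then show "(LINT x|M. g x \<bullet> grad \<phi> x) = l * (LINT x|M. u x \<bullet> \<phi> x)" by (simp add: b_def)
  qed
qed

text \<open>The number \<open>l\<close> of the eigenfunction lemma belongs to the set defining
  \<open>lambda1\<close>. No member \<open>\<mu>\<close> is smaller: testing its weak equation with
  approximations of its own eigenfunction shows that \<open>\<mu>\<close> is a Rayleigh
  quotient.\<close>

lemma lambda1_variational:
  shows lambda1_pos: "lambda1 \<Omega> > 0"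
    and lambda1_le: "H01 \<Omega> u g \<Longrightarrow> lambda1 \<Omega> * (Lnorm \<Omega> 2 u)\<^sup>2 \<le> (Lnorm \<Omega> 2 (\<lambda>x. norm (g x)))\<^sup>2"
proof -
  obtain l u0 g0 where l: "l > 0" "\<And>f. test_fun \<Omega> f \<Longrightarrow> l * mass f \<le> energy f"
    and u0: "H01 \<Omega> u0 g0" "(LINT x|M. (norm (u0 x))\<^sup>2) = 1"
    and eig: "\<And>\<phi>. test_fun \<Omega> \<phi> \<Longrightarrow> (LINT x|M. g0 x \<bullet> grad \<phi> x) = l * (LINT x|M. u0 x \<bullet> \<phi> x)"
    using eigenfunction by blast
  \<comment> \<open>The inequality for test functions extends to H_0^1 by density.\<close>
  have ray: "l * (LINT x|M. (norm (u x))\<^sup>2) \<le> (LINT x|M. (norm (g x))\<^sup>2)" if H: "H01 \<Omega> u g" for u g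
  proof -
    obtain \<phi> where *: "sqint M u" "sqint M g" "\<And>k. test_fun \<Omega> (\<phi> k)"
      "(\<lambda>k. LINT x|M. (norm (\<phi> k x - u x))\<^sup>2) \<longlonglongrightarrow> 0"
      "(\<lambda>k. LINT x|M. (norm (grad (\<phi> k) x - g x))\<^sup>2) \<longlonglongrightarrow> 0"
      using H unfolding H01_iff[OF meas] by blast
    have "(\<lambda>k. mass (\<phi> k)) \<longlonglongrightarrow> (LINT x|M. (norm (u x))\<^sup>2)" "(\<lambda>k. energy (\<phi> k)) \<longlonglongrightarrow> (LINT x|M. (norm (g x))\<^sup>2)"
      unfolding mass_def energy_def by (rule sqint_limit_norm sqint_test *)+
    then show ?thesis using l(2)[OF *(3)]
      by (intro LIMSEQ_le[OF tendsto_mult_left[of "\<lambda>k. mass (\<phi> k)"]]) auto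
  qed
  have "lambda1 \<Omega> = l"
    unfolding lambda1_def
  proof (rule cInf_eq_minimum)
    have "Lnorm \<Omega> 2 u0 \<noteq> 0" using u0(2) Lnorm_2_sq[OF meas, of u0] by auto
    then show "l \<in> {\<mu>. \<exists>u g. H01 \<Omega> u g \<and> Lnorm \<Omega> 2 u \<noteq> 0 \<and> (\<forall>\<phi>. test_fun \<Omega> \<phi> \<longrightarrow>
         (LINT x:\<Omega>|lebesgue. g x \<bullet> grad \<phi> x) = \<mu> * (LINT x:\<Omega>|lebesgue. u x * \<phi> x))}"
      using u0(1) eig by (auto simp: set_integral_lebesgue_on[OF meas])
  next
    fix \<mu> assume "\<mu> \<in> {\<mu>. \<exists>u g. H01 \<Omega> u g \<and> Lnorm \<Omega> 2 u \<noteq> 0 \<and> (\<forall>\<phi>. test_fun \<Omega> \<phi> \<longrightarrow>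
         (LINT x:\<Omega>|lebesgue. g x \<bullet> grad \<phi> x) = \<mu> * (LINT x:\<Omega>|lebesgue. u x * \<phi> x))}"
    then obtain u g where H: "H01 \<Omega> u g" and nz: "Lnorm \<Omega> 2 u \<noteq> 0"
      and e: "\<And>\<phi>. test_fun \<Omega> \<phi> \<Longrightarrow> (LINT x|M. g x \<bullet> grad \<phi> x) = \<mu> * (LINT x|M. u x \<bullet> \<phi> x)"
      by (auto simp: set_integral_lebesgue_on[OF meas])
    obtain \<phi> where *: "sqint M u" "sqint M g" "\<And>k. test_fun \<Omega> (\<phi> k)"
      "(\<lambda>k. LINT x|M. (norm (\<phi> k x - u x))\<^sup>2) \<longlonglongrightarrow> 0"
      "(\<lambda>k. LINT x|M. (norm (grad (\<phi> k) x - g x))\<^sup>2) \<longlonglongrightarrow> 0"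
      using H unfolding H01_iff[OF meas] by blast
    have "(\<lambda>k. LINT x|M. \<phi> k x \<bullet> u x) \<longlonglongrightarrow> (LINT x|M. u x \<bullet> u x)"
      "(\<lambda>k. LINT x|M. grad (\<phi> k) x \<bullet> g x) \<longlonglongrightarrow> (LINT x|M. g x \<bullet> g x)"
      by (rule sqint_limit_inner sqint_test *)+
    then have "(\<lambda>k. LINT x|M. u x \<bullet> \<phi> k x) \<longlonglongrightarrow> (LINT x|M. (norm (u x))\<^sup>2)"
      and g: "(\<lambda>k. LINT x|M. g x \<bullet> grad (\<phi> k) x) \<longlonglongrightarrow> (LINT x|M. (norm (g x))\<^sup>2)"
      unfolding power2_norm_eq_inner by (simp_all only: inner_commute)
    then have "(\<lambda>k. LINT x|M. g x \<bullet> grad (\<phi> k) x) \<longlonglongrightarrow> \<mu> * (LINT x|M. (norm (u x))\<^sup>2)"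
      unfolding e[OF *(3)] by (intro tendsto_mult_left)
    then have "(LINT x|M. (norm (g x))\<^sup>2) = \<mu> * (LINT x|M. (norm (u x))\<^sup>2)"
      using g LIMSEQ_unique by blast
    then have "l * (Lnorm \<Omega> 2 u)\<^sup>2 \<le> \<mu> * (Lnorm \<Omega> 2 u)\<^sup>2"
      using ray[OF H] by (simp add: Lnorm_2_sq[OF meas])
    then show "l \<le> \<mu>" using nz by simp
  qed
  then show "lambda1 \<Omega> > 0"
    and "H01 \<Omega> u g \<Longrightarrow> lambda1 \<Omega> * (Lnorm \<Omega> 2 u)\<^sup>2 \<le> (Lnorm \<Omega> 2 (\<lambda>x. norm (g x)))\<^sup>2"
    using l(1) ray[of u g] by (simp_all add: Lnorm_2_sq[OF meas])
qed

end

section \<open>The Nehari set\<close>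

lemma Lnorm_cmult:
  assumes "c \<ge> 0" "r > 0"
  shows "Lnorm \<Omega> r (\<lambda>x. c * u x) = c * Lnorm \<Omega> r u"
proof -
  have "(LINT x:\<Omega>|lebesgue. \<bar>c * u x\<bar> powr r) = c powr r * (LINT x:\<Omega>|lebesgue. \<bar>u x\<bar> powr r)"
    using assms by (simp add: abs_mult powr_mult)
  moreover have "0 \<le> (LINT x:\<Omega>|lebesgue. \<bar>u x\<bar> powr r)"
    unfolding set_lebesgue_integral_def by (intro integral_nonneg_AE) auto
  ultimately show ?thesis
    using assms by (simp add: Lnorm_def powr_mult powr_powr)
qed

text \<open>Division by \<open>t^2\<close> reduces the equation to \<open>h t = D\<close>. Here
  \<open>h 0 = 0\<close>, and \<open>h\<close> grows without bound since \<open>q - 1 > 2\<close>,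
  so the intermediate value theorem applies.\<close>

lemma power_dominates_root:
  fixes q B C D :: real
  assumes "q > 3" "C > 0" "B > 0" "D > 0"
  obtains t where "t > 0" "D * t\<^sup>2 + B * t ^ 4 = C * t powr (q + 1)"
proof -
  define h where "h t = C * t powr (q - 1) - B * t\<^sup>2" for t
  \<comment> \<open>Chosen so that \<open>C * T powr (q - 3)\<close> is at least
    \<open>B + D\<close>; the maximum with 1 gives \<open>D \<le> D * T^2\<close>.\<close>
  define T where "T = max 1 (((B + D) / C) powr (1 / (q - 3)))"
  have T1: "T \<ge> 1" by (simp add: T_def)
  have "(B + D) / C = (((B + D) / C) powr (1 / (q - 3))) powr (q - 3)"
    using assms by (simp add: powr_powr)
  also have "\<dots> \<le> T powr (q - 3)" using assms by (intro powr_mono2) (auto simp: T_def)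
  finally have T2: "B + D \<le> C * T powr (q - 3)" using assms by (simp add: field_simps)
  have "B * T\<^sup>2 + D \<le> (B + D) * T\<^sup>2"
    using T1 assms by (simp add: distrib_right)
  also have "\<dots> \<le> C * T powr (q - 3) * T\<^sup>2" using T2 by (rule mult_right_mono) simp
  also have "\<dots> = C * T powr (q - 1)"
    using T1 powr_add[of T "q - 3" 2] by simp
  finally have "D \<le> h T" by (simp add: h_def)
  moreover have "h 0 \<le> D" using assms by (simp add: h_def)
  moreover have "continuous_on {0..T} h"
    unfolding h_def using assms by (intro continuous_intros continuous_on_powr') auto
  ultimately obtain t where t: "0 \<le> t" "h t = D" using IVT'[of h 0 D T] T1 by auto
  have "t \<noteq> 0" using t(2) assms by (auto simp: h_def)
  then have tp: "t > 0" using t by simp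
  have "C * t powr (q + 1) = C * t powr (q - 1) * t\<^sup>2"
    using tp powr_add[of t "q - 1" 2] by (simp add: add.commute)
  also have "\<dots> = (D + B * t\<^sup>2) * t\<^sup>2" using t(2) by (simp add: h_def)
  finally show ?thesis using tp by (intro that[of t]) (simp_all add: algebra_simps power2_eq_square power4_eq_xxxx)
qed

text \<open>\<open>I\<close> vanishes at some point of the ray through a bump function. Nonemptiness
  is what turns \<open>s > depth\<close> into an element of level below \<open>s\<close>.\<close>

lemma Nehari_nonempty:
  fixes \<Omega> :: "(real^'n::finite) set"
  assumes "bounded_open \<Omega>" "a > 0" "b > 0" "q > 3"
  shows "Nehari \<Omega> a b q \<noteq> {}"
proof -
  interpret bounded_open \<Omega> by fact
  obtain f where f: "test_fun \<Omega> f" "\<And>r. r > 0 \<Longrightarrow> Lnorm \<Omega> r f > 0" "energy f > 0" using bump by blast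
  define A where "A = Lnorm \<Omega> 2 (\<lambda>x. norm (grad f x))"
  define C where "C = Lnorm \<Omega> (q + 1) f powr (q + 1)"
  have "A\<^sup>2 = energy f" by (simp add: A_def energy_def Lnorm_2_sq[OF meas])
  then have A: "A > 0" using f(3) Lnorm_nonneg[of \<Omega> 2] by (metis A_def less_eq_real_def less_irrefl power2_eq_square mult_zero_left)
  have C: "C > 0" using f(2)[of "q + 1"] assms by (simp add: C_def)
  obtain t where t: "t > 0" "a * A\<^sup>2 * t\<^sup>2 + b * A ^ 4 * t ^ 4 = C * t powr (q + 1)"
    using power_dominates_root[of q C "b * A ^ 4" "a * A\<^sup>2"] assms A C by auto
  have tf: "test_fun \<Omega> (\<lambda>x. t * f x)" by (rule test_fun_cmult[OF f(1)])
  have g: "Lnorm \<Omega> 2 (\<lambda>x. norm (grad (\<lambda>x. t * f x) x)) = t * A"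
    using t(1) Lnorm_cmult[of t 2 \<Omega> "\<lambda>x. norm (grad f x)"]
    by (simp add: grad_cmult[OF test_fun_smooth[OF f(1)]] A_def)
  have "Lnorm \<Omega> (q + 1) (\<lambda>x. t * f x) powr (q + 1) = t powr (q + 1) * C"
    using t(1) assms Lnorm_nonneg[of \<Omega>] by (simp add: Lnorm_cmult C_def powr_mult)
  then have "Ifun \<Omega> a b q (\<lambda>x. t * f x) (grad (\<lambda>x. t * f x)) = 0"
    using t(2) by (simp add: Ifun_def g power_mult_distrib mult_ac)
  then have "(\<lambda>x. t * f x, grad (\<lambda>x. t * f x)) \<in> Nehari \<Omega> a b q"
    using H01_test_fun[OF meas tf] g t(1) A by (simp add: Nehari_def)
  then show ?thesis by blast
qed

text \<open>Eliminating the L^(q+1) term of \<open>J\<close> by \<open>I = 0\<close> leaves two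
  nonnegative terms, since \<open>q > 3\<close>. Dropping the quartic one bounds \<open>J\<close>
  from below; raising its coefficient, by \<open>q - 3 \<le> 2 * (q - 1)\<close>, bounds
  \<open>J\<close> from above.\<close>

lemma Nehari_energy:
  fixes \<Omega> :: "(real^'n::finite) set"
  assumes "(u, g) \<in> Nehari \<Omega> a b q" "q > 3" "a > 0" "b > 0"
  defines "X \<equiv> Lnorm \<Omega> 2 (\<lambda>x. norm (g x))"
  shows "X > 0" "Lnorm \<Omega> (q + 1) u powr (q + 1) = a * X\<^sup>2 + b * X ^ 4"
    and "a * (q - 1) / (2 * (q + 1)) * X\<^sup>2 \<le> Jfun \<Omega> a b q u g"
    and "Jfun \<Omega> a b q u g \<le> (q - 1) / (2 * (q + 1)) * Lnorm \<Omega> (q + 1) u powr (q + 1)"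
proof -
  show "X > 0" using assms(1) Lnorm_nonneg[of \<Omega> 2 "\<lambda>x. norm (g x)"] by (auto simp: Nehari_def X_def)
  show Z: "Lnorm \<Omega> (q + 1) u powr (q + 1) = a * X\<^sup>2 + b * X ^ 4"
    using assms(1) by (simp add: Nehari_def Ifun_def X_def)
  have J: "Jfun \<Omega> a b q u g = a * (q - 1) / (2 * (q + 1)) * X\<^sup>2 + b * (q - 3) / (4 * (q + 1)) * X ^ 4"
  proof -
    have "a * (q - 1) / (2 * (q + 1)) = a / 2 - a / (q + 1)" "b * (q - 3) / (4 * (q + 1)) = b / 4 - b / (q + 1)"
      using assms(2) by (simp_all add: field_simps)
    then show ?thesis
      unfolding Jfun_def Z X_def[symmetric] by (simp add: left_diff_distrib add_divide_distrib distrib_left)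
  qed
  show "a * (q - 1) / (2 * (q + 1)) * X\<^sup>2 \<le> Jfun \<Omega> a b q u g"
    unfolding J using assms by (simp add: divide_nonneg_pos)
  have "b * (q - 3) / (4 * (q + 1)) * X ^ 4 \<le> (q - 1) / (2 * (q + 1)) * b * X ^ 4"
  proof (rule mult_right_mono)
    have "b * (q - 3) \<le> b * (2 * (q - 1))" using assms by (intro mult_left_mono) auto
    then show "b * (q - 3) / (4 * (q + 1)) \<le> (q - 1) / (2 * (q + 1)) * b"
      using assms by (simp add: field_simps)
  qed simp
  then show "Jfun \<Omega> a b q u g \<le> (q - 1) / (2 * (q + 1)) * Lnorm \<Omega> (q + 1) u powr (q + 1)"
    unfolding J Z by (simp add: algebra_simps)
qed

lemma Nehari_level_nonneg:
  assumes "(u, g) \<in> Nehari \<Omega> a b q" "q > 3" "a > 0" "b > 0"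
  shows "0 \<le> Jfun \<Omega> a b q u g"
proof -
  have "0 \<le> a * (q - 1) / (2 * (q + 1)) * (Lnorm \<Omega> 2 (\<lambda>x. norm (g x)))\<^sup>2"
    using assms by simp
  with Nehari_energy(3)[OF assms] show ?thesis by linarith
qed

lemma Nehari_norm_less:
  assumes "(u, g) \<in> Nehari_s \<Omega> a b q s" "q > 3" "a > 0" "b > 0"
  shows "(Lnorm \<Omega> 2 (\<lambda>x. norm (g x)))\<^sup>2 < 2 * (q + 1) * s / (a * (q - 1))"
proof -
  have "(u, g) \<in> Nehari \<Omega> a b q" "Jfun \<Omega> a b q u g < s"
    using assms(1) by (auto simp: Nehari_s_def)
  with Nehari_energy(3)[OF this(1) assms(2-)]
  have "a * (q - 1) / (2 * (q + 1)) * (Lnorm \<Omega> 2 (\<lambda>x. norm (g x)))\<^sup>2 < s" by linarith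
  then show ?thesis using assms by (simp add: field_simps)
qed

text \<open>The infimum in the definition of \<open>S\<close> is not shown to be positive: were it \<open>0\<close>, then \<open>S = 1 / 0 = 0\<close> and
  the left-hand side would be \<open>0\<close>.\<close>

lemma Nehari_gradient_lower_bound:
  assumes "(u, g) \<in> Nehari \<Omega> a b q" "q > 3" "a > 0" "b > 0" "Lnorm \<Omega> 2 u \<noteq> 0"
  shows "(2 * (q + 1) * depth \<Omega> a b q / (q - 1)) powr (1 / (q + 1)) / sobolev_S \<Omega> q
    \<le> Lnorm \<Omega> 2 (\<lambda>x. norm (g x))"
    and "0 \<le> sobolev_S \<Omega> q"
proof -
  define X where "X = Lnorm \<Omega> 2 (\<lambda>x. norm (g x))"
  define Z where "Z = Lnorm \<Omega> (q + 1) u"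
  define d where "d = depth \<Omega> a b q"
  define Q where "Q = {Lnorm \<Omega> 2 (\<lambda>x. norm (g x)) / Lnorm \<Omega> (q + 1) w | w g. H01 \<Omega> w g \<and> Lnorm \<Omega> 2 w \<noteq> 0}"
  note E = Nehari_energy[OF assms(1-4)]
  have bb: "bdd_below ((\<lambda>(u, g). Jfun \<Omega> a b q u g) ` Nehari \<Omega> a b q)"
    using Nehari_level_nonneg[OF _ assms(2-4)] by (intro bdd_belowI[of _ 0]) auto
  have "0 \<le> d" unfolding d_def depth_def
    by (rule cInf_greatest) (use assms(1) Nehari_level_nonneg[OF _ assms(2-4)] in auto)
  have "d \<le> Jfun \<Omega> a b q u g"
    unfolding d_def depth_def by (rule cInf_lower[OF _ bb]) (use assms(1) in force)
  then have "d \<le> (q - 1) / (2 * (q + 1)) * Z powr (q + 1)"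
    using E(4) by (simp add: Z_def)
  then have "2 * (q + 1) * d / (q - 1) \<le> Z powr (q + 1)" using assms(2) by (simp add: field_simps)
  then have "(2 * (q + 1) * d / (q - 1)) powr (1 / (q + 1)) \<le> (Z powr (q + 1)) powr (1 / (q + 1))"
    using \<open>0 \<le> d\<close> assms(2) by (intro powr_mono2) auto
  also have "\<dots> = Z" using assms(2) Lnorm_nonneg[of \<Omega> "q + 1" u] by (simp add: powr_powr Z_def)
  finally have N: "(2 * (q + 1) * d / (q - 1)) powr (1 / (q + 1)) \<le> Z" .
  have "Z powr (q + 1) > 0" unfolding Z_def E(2) using E(1) assms by (simp add: add_pos_pos)
  then have Zp: "Z > 0" using Lnorm_nonneg[of \<Omega> "q + 1" u] by (cases "Z = 0") (auto simp: Z_def)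
  \<comment> \<open>The nonzero L^2 norm admits \<open>u\<close> as a competitor in the Sobolev
    quotient.\<close>
  have XQ: "X / Z \<in> Q" using assms(1,5) by (auto simp: Q_def X_def Z_def Nehari_def)
  have Q0: "0 \<le> y" if "y \<in> Q" for y using that by (auto simp: Q_def intro!: divide_nonneg_nonneg Lnorm_nonneg)
  have "Inf Q \<le> X / Z" by (rule cInf_lower[OF XQ bdd_belowI[OF Q0]])
  moreover have IQ: "0 \<le> Inf Q" by (rule cInf_greatest) (use XQ Q0 in auto)
  ultimately have "(2 * (q + 1) * d / (q - 1)) powr (1 / (q + 1)) * Inf Q \<le> Z * (X / Z)"
    using N Zp by (intro mult_mono) auto
  then show "(2 * (q + 1) * depth \<Omega> a b q / (q - 1)) powr (1 / (q + 1)) / sobolev_S \<Omega> q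
      \<le> Lnorm \<Omega> 2 (\<lambda>x. norm (g x))"
    using Zp by (simp add: sobolev_S_def Q_def[symmetric] d_def X_def)
  show "0 \<le> sobolev_S \<Omega> q" using IQ by (simp add: sobolev_S_def Q_def[symmetric])
qed

text \<open>Cancelling \<open>X powr p\<close> gathers the powers of \<open>X\<close> on the left.
  Monotonicity is used in the outer root only, so both signs of \<open>2 - p\<close> are
  covered.\<close>

lemma Gagliardo_Nirenberg_inversion:
  fixes a G X Y p \<gamma> :: real
  assumes "a * X\<^sup>2 \<le> G * X powr p * Y powr \<gamma>" "a > 0" "G > 0" "X > 0" "Y \<ge> 0" "\<gamma> > 0"
  shows "(a / G) powr (1 / \<gamma>) * X powr ((2 - p) / \<gamma>) \<le> Y"
proof -
  have "a * X powr (2 - p) * X powr p \<le> G * Y powr \<gamma> * X powr p"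
    using assms powr_add[of X "2 - p" p] by (simp add: mult_ac)
  then have "a / G * X powr (2 - p) \<le> Y powr \<gamma>"
    using assms by (simp add: field_simps)
  then have "(a / G * X powr (2 - p)) powr (1 / \<gamma>) \<le> (Y powr \<gamma>) powr (1 / \<gamma>)"
    using assms by (intro powr_mono2) auto
  moreover have "(a / G * X powr (2 - p)) powr (1 / \<gamma>) = (a / G) powr (1 / \<gamma>) * X powr ((2 - p) / \<gamma>)"
    using assms by (subst powr_mult) (simp_all add: powr_powr)
  ultimately show ?thesis using assms by (simp add: powr_powr)
qed

section \<open>Two-sided bound for the L^2 norm on the sublevels of \<open>J\<close>\<close>

theorem theorem1p5:
  fixes \<Omega> :: "(real^'n::finite) set" and a b q s G :: real
  assumes dom: "smooth_bounded_domain \<Omega>"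
    and ab: "a > 0" "b > 0"
    and q3: "q > 3"
    and qcrit: "CARD('n) \<ge> 3 \<Longrightarrow> q < 2 * real CARD('n) / (real CARD('n) - 2) - 1"
    and gam: "q + 1 - real CARD('n) * (q - 1) / 2 > 0"
    and Gpos: "G > 0"
    and GN: "\<And>u g. H01 \<Omega> u g \<Longrightarrow>
       (Lnorm \<Omega> (q + 1) u) powr (q + 1) \<le>
         G * (Lnorm \<Omega> 2 (\<lambda>x. norm (g x))) powr (real CARD('n) * (q - 1) / 2)
           * (Lnorm \<Omega> 2 u) powr (q + 1 - real CARD('n) * (q - 1) / 2)"
    and sd: "s > depth \<Omega> a b q"
  shows
    "let n = real CARD('n); \<gamma> = q + 1 - n * (q - 1) / 2; d = depth \<Omega> a b q;
         S = sobolev_S \<Omega> q;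
         \<theta> = (2 * (q + 1) * d / (q - 1)) powr (1 / (q + 1)) / S;
         K2 = sqrt (2 * (q + 1) * s / (a * lambda1 \<Omega> * (q - 1)));
         K1 = (if q \<le> 1 + 4 / n
               then (a / G) powr (1 / \<gamma>) * \<theta> powr ((4 - n * (q - 1)) / (2 * \<gamma>))
               else (a / G) powr (1 / \<gamma>) * (2 * (q + 1) * s / (a * (q - 1))) powr ((4 - n * (q - 1)) / (4 * \<gamma>)));
         lam_s = Inf ((\<lambda>(u, g). Lnorm \<Omega> 2 u) ` Nehari_s \<Omega> a b q s);
         Lam_s = Sup ((\<lambda>(u, g). Lnorm \<Omega> 2 u) ` Nehari_s \<Omega> a b q s)
     in K1 \<le> lam_s \<and> lam_s \<le> Lam_s \<and> Lam_s \<le> K2"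
proof -
  have bo: "bounded_open \<Omega>" using dom by (simp add: smooth_bounded_domain_def bounded_open_def)
  interpret bounded_open \<Omega> by fact
  define n where "n = real CARD('n)"
  have n: "n > 0" by (simp add: n_def)
  define \<gamma> where "\<gamma> = q + 1 - n * (q - 1) / 2"
  have \<gamma>: "\<gamma> > 0" using gam by (simp add: \<gamma>_def n_def)
  define \<theta> where "\<theta> = (2 * (q + 1) * depth \<Omega> a b q / (q - 1)) powr (1 / (q + 1)) / sobolev_S \<Omega> q"
  define W where "W = 2 * (q + 1) * s / (a * (q - 1))"
  define K2 where "K2 = sqrt (2 * (q + 1) * s / (a * lambda1 \<Omega> * (q - 1)))"
  define K1 where "K1 = (if q \<le> 1 + 4 / n
               then (a / G) powr (1 / \<gamma>) * \<theta> powr ((4 - n * (q - 1)) / (2 * \<gamma>))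
               else (a / G) powr (1 / \<gamma>) * W powr ((4 - n * (q - 1)) / (4 * \<gamma>)))"
  define L where "L = (\<lambda>(u, g). Lnorm \<Omega> 2 u) ` Nehari_s \<Omega> a b q s"
  have bb: "bdd_below ((\<lambda>(u, g). Jfun \<Omega> a b q u g) ` Nehari \<Omega> a b q)"
    using Nehari_level_nonneg[OF _ q3 ab] by (intro bdd_belowI[of _ 0]) auto
  have "\<exists>y\<in>(\<lambda>(u, g). Jfun \<Omega> a b q u g) ` Nehari \<Omega> a b q. y < s"
    using sd Nehari_nonempty[OF bo ab q3] cInf_less_iff[OF _ bb] by (simp add: depth_def)
  then have Lne: "L \<noteq> {}" by (auto simp: L_def Nehari_s_def)
  have bounds: "K1 \<le> y \<and> y \<le> K2" if yL: "y \<in> L" for y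
  proof -
    obtain u g where ug: "(u, g) \<in> Nehari_s \<Omega> a b q s" and y: "y = Lnorm \<Omega> 2 u"
      using yL by (auto simp: L_def)
    have N: "(u, g) \<in> Nehari \<Omega> a b q" and H: "H01 \<Omega> u g"
      using ug by (auto simp: Nehari_s_def Nehari_def)
    define X where "X = Lnorm \<Omega> 2 (\<lambda>x. norm (g x))"
    note E = Nehari_energy[OF N q3 ab, folded X_def]
    have XW: "X\<^sup>2 < W" using Nehari_norm_less[OF ug q3 ab] by (simp add: X_def W_def)
    have y0: "y \<ge> 0" by (simp add: y Lnorm_nonneg)
    have "lambda1 \<Omega> * y\<^sup>2 \<le> W" using lambda1_le[OF H] XW by (simp add: X_def y)
    then have "y\<^sup>2 \<le> W / lambda1 \<Omega>" using lambda1_pos by (simp add: field_simps)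
    then have "y \<le> K2" using y0 by (simp add: K2_def W_def real_le_rsqrt mult_ac)
    moreover
    \<comment> \<open>On the Nehari set the left side of the Gagliardo-Nirenberg inequality is
      \<open>a * X^2 + b * X^4\<close>; the quartic term is dropped.\<close>
    have "a * X\<^sup>2 \<le> G * X powr (n * (q - 1) / 2) * y powr \<gamma>"
      using GN[OF H] ab(2) unfolding X_def[symmetric] y[symmetric] n_def[symmetric] \<gamma>_def[symmetric] E(2)
      by (smt (verit) mult_nonneg_nonneg zero_le_even_power even_numeral)
    \<comment> \<open>\<open>y = 0\<close> would make the right-hand side 0 while
      \<open>a * X^2 > 0\<close>.\<close>
    then have low: "(a / G) powr (1 / \<gamma>) * X powr ((2 - n * (q - 1) / 2) / \<gamma>) \<le> y"
      and "y \<noteq> 0"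
      using Gagliardo_Nirenberg_inversion[OF _ ab(1) Gpos E(1) y0 \<gamma>] ab(1) E(1)
      by (auto simp: mult_le_0_iff)
    have e: "(2 - n * (q - 1) / 2) / \<gamma> = (4 - n * (q - 1)) / (2 * \<gamma>)"
      using \<gamma> by (simp add: field_simps)
    have "K1 \<le> (a / G) powr (1 / \<gamma>) * X powr ((4 - n * (q - 1)) / (2 * \<gamma>))"
    proof (cases "q \<le> 1 + 4 / n")
      case True
      \<comment> \<open>The exponent is nonnegative, so the lower bound on \<open>X\<close> counts.
        At exponent 0 the convention \<open>0 powr 0 = 0\<close> keeps the comparison valid for
        \<open>\<theta> = 0\<close>.\<close>
      have "0 \<le> \<theta>" "\<theta> \<le> X"
        using Nehari_gradient_lower_bound[OF N q3 ab] \<open>y \<noteq> 0\<close> by (simp_all add: \<theta>_def X_def y)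
      moreover have "0 \<le> 4 - n * (q - 1)" using True n by (simp add: field_simps)
      ultimately have "\<theta> powr ((4 - n * (q - 1)) / (2 * \<gamma>)) \<le> X powr ((4 - n * (q - 1)) / (2 * \<gamma>))"
        using \<gamma> by (intro powr_mono2) auto
      then show ?thesis using True by (simp add: K1_def mult_left_mono)
    next
      case False
      \<comment> \<open>The exponent is negative, so the power decreases in \<open>X\<close> and the
        upper bound on \<open>X\<close> counts.\<close>
      have "0 \<le> W" using XW zero_le_power2[of X] by linarith
      then have "X \<le> W powr (1 / 2)"
        using XW by (simp add: powr_half_sqrt real_le_rsqrt less_imp_le)
      moreover have "4 - n * (q - 1) \<le> 0" using False n by (simp add: field_simps)
      ultimately have "(W powr (1 / 2)) powr ((4 - n * (q - 1)) / (2 * \<gamma>)) \<le> X powr ((4 - n * (q - 1)) / (2 * \<gamma>))"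
        using \<gamma> E(1) by (intro powr_mono2') (auto simp: divide_nonpos_pos)
      then have "W powr ((4 - n * (q - 1)) / (4 * \<gamma>)) \<le> X powr ((4 - n * (q - 1)) / (2 * \<gamma>))"
        by (simp add: powr_powr)
      then show ?thesis using False by (simp add: K1_def mult_left_mono)
    qed
    then have "K1 \<le> y" using low unfolding e by linarith
    ultimately show ?thesis by simp
  qed
  have "K1 \<le> Inf L" "Sup L \<le> K2"
    using Lne bounds by (auto intro: cInf_greatest cSup_least)
  \<comment> \<open>Needs \<open>L\<close> nonempty and bounded on both sides, which
    \<open>bounds\<close> provides.\<close>
  moreover have "Inf L \<le> Sup L"
    using bdd_belowI[of L K1] bdd_aboveI[of L K2] bounds by (intro cInf_le_cSup Lne) auto
  ultimately show ?thesis
    unfolding Let_def n_def[symmetric] \<gamma>_def[symmetric] \<theta>_def[symmetric] W_def[symmetric]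
      K1_def[symmetric] K2_def[symmetric] L_def[symmetric] by blast
qed

end
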